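(* Suppose $H$ is a finite dimensional biperfect weak Hopf algebra over a field $k$ with invertible weak antipode $T$, and let $D(H)$ be its quantum double. Then for a $k$-linear space $V$, the following statements are equivalent: (i) $V$ is a left $D(H)$-module; (ii) $V$ is a crossed $H$-bimodule and satisfies $$\sum_{(a)(\beta)}T^{-1}(a''')a''\beta_H\otimes a'\beta_V=\sum_{(\beta)}\beta_H\otimes a\beta_V$$ for all $a\in H$ and $\beta\in V$.
   Context: $k$ is a field. Sweedler notation: $\Delta(x)=\sum_{(x)}x'\otimes x''$, iterated $\sum_{(x)}x'\otimes x''\otimes x'''$. $\ast$ is the convolution product on $\mathrm{Hom}_k(H,H)$. A weak Hopf algebra is a bialgebra $H$ over $k$ for which there exists $T\in \mathrm{Hom}_k(H,H)$ (a weak antipode) such that $id\ast T\ast id=id$ and $T\ast id\ast T=T$. It is perfect if $T$ is an anti-bialgebra morphism (anti-algebra and anti-coalgebra morphism) and $(id\ast T)(H)\subseteq C(H)$ (the center of $H$); coperfect if $T$ is an anti-bialgebra morphism and $\sum_{(x)}x'T(x'')\otimes x'''=\sum_{(x)}x''T(x''')\otimes x'$ for all $x\in H$; biperfect if it is both perfect and coperfect. A crossed $H$-bimodule (for a bialgebra $H$) is a vector space $V$ with linear maps $\mu_V:H\otimes V\to V$, written $\mu_V(a\otimes\beta)=a\beta$, and $\Delta_V:V\to V\otimes H$, written $\Delta_V(\beta)=\sum_{(\beta)}\beta_V\otimes\beta_H$, making $V$ a left $H$-module and a right $H$-comodule respectively, such that for all $a\in H$, $\beta\in V$, $$\sum_{(a)(\beta)}a'\beta_V\otimes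 a''\beta_H=\sum_{(a)(a''\beta)}(a''\beta)_V\otimes(a''\beta)_H a'.$$ The notation $a\beta$, $\beta_V$, $\beta_H$ in the identity of (ii) refers to this action and coaction. An almost bialgebra is a vector space that is both a unital algebra and a counital coalgebra with $\Delta(xy)=\Delta(x)\Delta(y)$. Quantum double. For $H$ a finite dimensional biperfect weak Hopf algebra with invertible weak antipode $T$, $H^{\ast cop}$ is the dual space $H^\ast$ with convolution multiplication $(fg)(a)=\sum_{(a)} f(a')g(a'')$, unit $\varepsilon$ (also written $1$), comultiplication opposite to the dual of the multiplication of $H$ (so $\sum_{(f)}f'(a)f''(b)=f(ba)$), counit $f\mapsto f(1)$, and weak antipode $T^{\ast-1}$. For $a\in H$, $f\in H^{\ast cop}$ (Sweedler notation for $f$ taken in $H^{\ast cop}$) put $a\triangleright f=\sum_{(f)}\langle f'T^{\ast-1}(f'''),a\rangle f''$ and $a\triangleleft f=\sum_{(a)}\langle f,T^{-1}(a''')a'\rangle a''$, where $\langle\ ,\ \rangle$ is evaluation. The quantum double $D(H)=H^{\ast cop}\infty H$ is the vector space $H^{\ast cop}\otimes H$ (with $f\otimes a$ written $f\infty a$) with the almost bialgebra structure having identity $1\infty 1=\varepsilon\infty 1$, product $(f\infty a)(g\infty b)=\sum_{(a)(g)}f(a'\triangleright g')\infty(a''\triangleleft g'')b$, coproduct $\Delta(f\infty a)=\sum_{(a)(f)}(f'\infty a')\otimes(f''\infty a'')$ and counit $\varepsilon(f\infty a)=f(1)\varepsilon(a)$. *)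

theory Defs
  imports Complex_Main "HOL-Library.Function_Algebras" "HOL-Library.FuncSet"
begin

section \<open>Vector spaces and linear maps\<close>

text \<open>A vector space is given by a scalar multiplication on a type of class
  \<open>ab_group_add\<close> and a subspace of that type. The carrier is needed because the dual of
  a space and the tensor product of two spaces are proper subspaces of function types (with
  the pointwise operations of \<open>Function_Algebras\<close>).\<close>

record ('k, 'u) vspace =
  vecs :: "'u set"
  smul :: "'k \<Rightarrow> 'u \<Rightarrow> 'u"

definition is_vspace :: "('k::field, 'u::ab_group_add) vspace \<Rightarrow> bool" where
  "is_vspace A \<longleftrightarrow> vector_space (smul A) \<and> module.subspace (smul A) (vecs A)"

definition linear_map ::
    "('k, 'u::plus) vspace \<Rightarrow> ('k, 'w::plus) vspace \<Rightarrow> ('u \<Rightarrow> 'w) \<Rightarrow> bool" where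
  "linear_map A C f \<longleftrightarrow> (\<forall>u\<in>vecs A. f u \<in> vecs C) \<and>
     (\<forall>u\<in>vecs A. \<forall>v\<in>vecs A. f (u + v) = f u + f v) \<and>
     (\<forall>c. \<forall>u\<in>vecs A. f (smul A c u) = smul C c (f u))"

definition bilinear_map ::
    "('k, 'u::plus) vspace \<Rightarrow> ('k, 'v::plus) vspace \<Rightarrow> ('k, 'w::plus) vspace \<Rightarrow>
     ('u \<Rightarrow> 'v \<Rightarrow> 'w) \<Rightarrow> bool" where
  "bilinear_map A B C F \<longleftrightarrow> (\<forall>u\<in>vecs A. linear_map B C (F u)) \<and>
     (\<forall>v\<in>vecs B. linear_map A C (\<lambda>u. F u v))"

definition full_space :: "('k \<Rightarrow> 'u \<Rightarrow> 'u) \<Rightarrow> ('k, 'u) vspace" where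
  "full_space s = \<lparr>vecs = UNIV, smul = s\<rparr>"

abbreviation scalars :: "('k::field, 'k) vspace" where
  "scalars \<equiv> full_space (*)"

definition dual_space :: "('k::field \<Rightarrow> 'u::ab_group_add \<Rightarrow> 'u) \<Rightarrow> ('k, 'u \<Rightarrow> 'k) vspace" where
  "dual_space s = \<lparr>vecs = {f. linear_map (full_space s) scalars f}, smul = (\<lambda>c f x. c * f x)\<rparr>"


section \<open>Tensor products and Sweedler sums\<close>

text \<open>The tensor product of \<open>A\<close> and \<open>B\<close> is realised inside the space of functionals
  on the bilinear forms on \<open>A \<times> B\<close>: the pure tensor of \<open>u\<close> and \<open>v\<close> is evaluation
  at \<open>(u, v)\<close>, and the tensor product is the set of finite sums of pure tensors.
  Lemmas \<open>tensor_sum_well_defined\<close> and \<open>tensor_universal\<close> below give its universal property.\<close>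

definition pure_tensor ::
    "('k::field, 'u::plus) vspace \<Rightarrow> ('k, 'v::plus) vspace \<Rightarrow> 'u \<Rightarrow> 'v \<Rightarrow> ('u \<Rightarrow> 'v \<Rightarrow> 'k) \<Rightarrow> 'k" where
  "pure_tensor A B u v = (\<lambda>F. if bilinear_map A B scalars F then F u v else 0)"

definition represents ::
    "('k::field, 'u::plus) vspace \<Rightarrow> ('k, 'v::plus) vspace \<Rightarrow> ('u \<times> 'v) list \<Rightarrow>
     (('u \<Rightarrow> 'v \<Rightarrow> 'k) \<Rightarrow> 'k) \<Rightarrow> bool" where
  "represents A B xs t \<longleftrightarrow> set xs \<subseteq> vecs A \<times> vecs B \<and> t = (\<Sum>(u, v)\<leftarrow>xs. pure_tensor A B u v)"

definition tensor_space ::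
    "('k::field, 'u::plus) vspace \<Rightarrow> ('k, 'v::plus) vspace \<Rightarrow>
     ('k, ('u \<Rightarrow> 'v \<Rightarrow> 'k) \<Rightarrow> 'k) vspace" where
  "tensor_space A B = \<lparr>vecs = {t. \<exists>xs. represents A B xs t}, smul = (\<lambda>c t F. c * t F)\<rparr>"

text \<open>The Sweedler sum: write \<open>t\<close> as a sum of pure tensors of \<open>u\<close> and \<open>v\<close>, and sum
  \<open>F u v\<close>. The result does not depend on the choice as long as \<open>F\<close> is bilinear.\<close>

definition tensor_sum ::
    "('k::field, 'u::plus) vspace \<Rightarrow> ('k, 'v::plus) vspace \<Rightarrow> (('u \<Rightarrow> 'v \<Rightarrow> 'k) \<Rightarrow> 'k) \<Rightarrow>
     ('u \<Rightarrow> 'v \<Rightarrow> 'w::monoid_add) \<Rightarrow> 'w" where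
  "tensor_sum A B t F = (\<Sum>(u, v)\<leftarrow>(SOME xs. represents A B xs t). F u v)"

lemma sum_list_tensor_apply:
  "(\<Sum>(u, v)\<leftarrow>xs. G u v) F = (\<Sum>(u, v)\<leftarrow>xs. (G u v F :: 'k::comm_monoid_add))"
  by (induction xs) auto

lemma linear_functional_separates:
  assumes "vector_space (s :: 'k::field \<Rightarrow> 'w::ab_group_add \<Rightarrow> 'w)" "w \<noteq> 0"
  shows "\<exists>f. linear_map (full_space s) scalars f \<and> f w \<noteq> 0"
proof -
  interpret vector_space_pair s "(*) :: 'k \<Rightarrow> 'k \<Rightarrow> 'k"
    using assms(1) by (simp add: vector_space_pair_def vector_space_def algebra_simps)
  have "vs1.independent {w}" using assms(2) by simp
  from linear_independent_extend[OF this, of "\<lambda>_. 1"]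
  obtain f where f: "Vector_Spaces.linear s (*) f" "f w = 1" by auto
  have "linear_map (full_space s) scalars f"
    using linear_add[OF f(1)] linear_scale[OF f(1)]
    by (simp add: linear_map_def full_space_def)
  with f(2) show ?thesis by auto
qed

lemma tensor_sum_well_defined:
  fixes C :: "('k::field, 'w::ab_group_add) vspace"
  assumes C: "is_vspace C" and F: "bilinear_map A B C F"
    and xs: "represents A B xs t" and ys: "represents A B ys t"
  shows "(\<Sum>(u, v)\<leftarrow>xs. F u v) = (\<Sum>(u, v)\<leftarrow>ys. F u v)"
proof (rule ccontr)
  assume ne: "\<not> ?thesis"
  have vs: "vector_space (smul C)" using C by (simp add: is_vspace_def)
  from ne have "(\<Sum>(u, v)\<leftarrow>xs. F u v) - (\<Sum>(u, v)\<leftarrow>ys. F u v) \<noteq> 0" by simp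
  from linear_functional_separates[OF vs this] obtain f
    where f: "linear_map (full_space (smul C)) scalars f"
      and fn: "f ((\<Sum>(u, v)\<leftarrow>xs. F u v) - (\<Sum>(u, v)\<leftarrow>ys. F u v)) \<noteq> 0" by blast
  have add: "f (a + b) = f a + f b" for a b
    using f by (simp add: linear_map_def full_space_def)
  have zero: "f 0 = 0" using add[of 0 0] by (metis add_cancel_right_right add_0_right)
  have sum: "f (\<Sum>(u, v)\<leftarrow>zs. F u v) = (\<Sum>(u, v)\<leftarrow>zs. f (F u v))" for zs
    by (induction zs) (auto simp: add zero)
  have bil: "bilinear_map A B scalars (\<lambda>u v. f (F u v))"
    using F f by (simp add: bilinear_map_def linear_map_def full_space_def)
  have ev: "t (\<lambda>u v. f (F u v)) = (\<Sum>(u, v)\<leftarrow>zs. f (F u v))" if "represents A B zs t" for zs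
    using that bil by (simp add: represents_def sum_list_tensor_apply pure_tensor_def)
  have "f (\<Sum>(u, v)\<leftarrow>xs. F u v) = f (\<Sum>(u, v)\<leftarrow>ys. F u v)"
    using ev[OF xs] ev[OF ys] by (simp add: sum)
  moreover have "f (a - b) = f a - f b" for a b
    using add[of "a - b" b] by simp
  ultimately show False using fn by simp
qed

lemma tensor_sum_eq:
  fixes C :: "('k::field, 'w::ab_group_add) vspace"
  assumes "is_vspace C" "bilinear_map A B C F" "represents A B xs t"
  shows "tensor_sum A B t F = (\<Sum>(u, v)\<leftarrow>xs. F u v)"
  unfolding tensor_sum_def
  by (rule tensor_sum_well_defined[OF assms(1,2) someI assms(3)]) (rule assms(3))

lemma linear_map_zero:
  fixes A :: "('k::field, 'u::ab_group_add) vspace" and C :: "('k, 'w::ab_group_add) vspace"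
  assumes "is_vspace A" "linear_map A C f"
  shows "f 0 = 0"
proof -
  have vs: "module (smul A)"
    using assms(1) by (simp add: is_vspace_def module_iff_vector_space)
  have "0 \<in> vecs A" using assms(1) module.subspace_0[OF vs] by (simp add: is_vspace_def)
  hence "f (0 + 0) = f 0 + f 0" using assms(2) unfolding linear_map_def by blast
  thus ?thesis by simp
qed

lemma tensor_universal:
  fixes A :: "('k::field, 'u::ab_group_add) vspace" and B :: "('k, 'v::ab_group_add) vspace"
    and C :: "('k, 'w::ab_group_add) vspace"
  assumes A: "is_vspace A" and C: "is_vspace C" and F: "bilinear_map A B C F"
  shows "linear_map (tensor_space A B) C (\<lambda>t. tensor_sum A B t F)"
    and "\<lbrakk>u \<in> vecs A; v \<in> vecs B\<rbrakk> \<Longrightarrow> tensor_sum A B (pure_tensor A B u v) F = F u v"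
proof -
  note eq = tensor_sum_eq[OF C F]
  show "\<lbrakk>u \<in> vecs A; v \<in> vecs B\<rbrakk> \<Longrightarrow> tensor_sum A B (pure_tensor A B u v) F = F u v"
    using eq[of "[(u, v)]" "pure_tensor A B u v"] by (simp add: represents_def)
  interpret vector_space "smul C" using C by (simp add: is_vspace_def)
  have sub: "subspace (vecs C)" using C by (simp add: is_vspace_def)
  have zC: "\<And>v. v \<in> vecs B \<Longrightarrow> F 0 v = 0"
    using F linear_map_zero[OF A] unfolding bilinear_map_def by blast
  have modA: "module (smul A)" and subA: "module.subspace (smul A) (vecs A)"
    using A by (auto simp: is_vspace_def module_iff_vector_space)
  have mem: "(\<Sum>(u, v)\<leftarrow>xs. F u v) \<in> vecs C" if "set xs \<subseteq> vecs A \<times> vecs B" for xs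
    using that F
    by (induction xs)
      (auto simp: subspace_0[OF sub] bilinear_map_def linear_map_def intro!: subspace_add[OF sub])
  have scal: "represents A B (map (\<lambda>(u, v). (smul A c u, v)) xs) (\<lambda>F. c * t F) \<and>
      (\<Sum>(u, v)\<leftarrow>map (\<lambda>(u, v). (smul A c u, v)) xs. F u v) = smul C c (\<Sum>(u, v)\<leftarrow>xs. F u v)"
    if "represents A B xs t" for c xs t
  proof -
    have x: "set xs \<subseteq> vecs A \<times> vecs B" and t: "t = (\<Sum>(u, v)\<leftarrow>xs. pure_tensor A B u v)"
      using that by (auto simp: represents_def)
    have p: "pure_tensor A B (smul A c u) v G = c * pure_tensor A B u v G"
      if "u \<in> vecs A" "v \<in> vecs B" for u v G
      using that by (auto simp: pure_tensor_def bilinear_map_def linear_map_def full_space_def)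
    have "(\<lambda>G. c * (\<Sum>(u, v)\<leftarrow>xs. pure_tensor A B u v) G) =
        (\<Sum>(u, v)\<leftarrow>map (\<lambda>(u, v). (smul A c u, v)) xs. pure_tensor A B u v)"
    proof
      fix G
      show "c * (\<Sum>(u, v)\<leftarrow>xs. pure_tensor A B u v) G =
        (\<Sum>(u, v)\<leftarrow>map (\<lambda>(u, v). (smul A c u, v)) xs. pure_tensor A B u v) G"
        using x by (induction xs) (auto simp: p algebra_simps)
    qed
    moreover have "(\<Sum>(u, v)\<leftarrow>map (\<lambda>(u, v). (smul A c u, v)) xs. F u v) =
        smul C c (\<Sum>(u, v)\<leftarrow>xs. F u v)"
      using x F
      by (induction xs) (auto simp: scale_right_distrib bilinear_map_def linear_map_def)
    ultimately show ?thesis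
      using x t module.subspace_scale[OF modA subA] by (auto simp: represents_def)
  qed
  show "linear_map (tensor_space A B) C (\<lambda>t. tensor_sum A B t F)"
    unfolding linear_map_def
  proof (intro conjI ballI allI)
    fix t assume "t \<in> vecs (tensor_space A B)"
    then obtain xs where xs: "represents A B xs t" by (auto simp: tensor_space_def)
    show "tensor_sum A B t F \<in> vecs C"
      using mem[of xs] xs unfolding eq[OF xs] represents_def by blast
    fix c
    show "tensor_sum A B (smul (tensor_space A B) c t) F = smul C c (tensor_sum A B t F)"
      using eq[OF conjunct1[OF scal[OF xs]]] scal[OF xs]
      by (simp add: eq[OF xs] tensor_space_def)
  next
    fix t t' assume "t \<in> vecs (tensor_space A B)" "t' \<in> vecs (tensor_space A B)"
    then obtain xs ys where xs: "represents A B xs t" and ys: "represents A B ys t'"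
      by (auto simp: tensor_space_def)
    have "represents A B (xs @ ys) (t + t')"
      using xs ys by (auto simp: represents_def)
    from eq[OF this] show "tensor_sum A B (t + t') F = tensor_sum A B t F + tensor_sum A B t' F"
      by (simp add: eq[OF xs] eq[OF ys])
  qed
qed


section \<open>Modules and comodules\<close>

definition left_module ::
    "('k::field, 'a::plus) vspace \<Rightarrow> ('a \<Rightarrow> 'a \<Rightarrow> 'a) \<Rightarrow> 'a \<Rightarrow> ('k, 'v::plus) vspace \<Rightarrow>
     ('a \<Rightarrow> 'v \<Rightarrow> 'v) \<Rightarrow> bool" where
  "left_module A mult one V act \<longleftrightarrow> bilinear_map A V V act \<and>
     (\<forall>\<beta>\<in>vecs V. act one \<beta> = \<beta>) \<and>
     (\<forall>x\<in>vecs A. \<forall>y\<in>vecs A. \<forall>\<beta>\<in>vecs V. act (mult x y) \<beta> = act x (act y \<beta>))"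

definition right_comodule ::
    "('k::field, 'h::plus) vspace \<Rightarrow> ('h \<Rightarrow> ('h \<Rightarrow> 'h \<Rightarrow> 'k) \<Rightarrow> 'k) \<Rightarrow> ('h \<Rightarrow> 'k) \<Rightarrow>
     ('k, 'v::monoid_add) vspace \<Rightarrow> ('v \<Rightarrow> ('v \<Rightarrow> 'h \<Rightarrow> 'k) \<Rightarrow> 'k) \<Rightarrow> bool" where
  "right_comodule H \<Delta> \<epsilon> V \<delta> \<longleftrightarrow> linear_map V (tensor_space V H) \<delta> \<and>
     (\<forall>\<beta>\<in>vecs V.
        tensor_sum V H (\<delta> \<beta>) (\<lambda>\<beta>\<^sub>V \<beta>\<^sub>H. tensor_sum V H (\<delta> \<beta>\<^sub>V)
          (\<lambda>\<gamma> x. pure_tensor V (tensor_space H H) \<gamma> (pure_tensor H H x \<beta>\<^sub>H)))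
      = tensor_sum V H (\<delta> \<beta>) (\<lambda>\<beta>\<^sub>V \<beta>\<^sub>H. pure_tensor V (tensor_space H H) \<beta>\<^sub>V (\<Delta> \<beta>\<^sub>H))) \<and>
     (\<forall>\<beta>\<in>vecs V. tensor_sum V H (\<delta> \<beta>) (\<lambda>\<beta>\<^sub>V \<beta>\<^sub>H. smul V (\<epsilon> \<beta>\<^sub>H) \<beta>\<^sub>V) = \<beta>)"


section \<open>Bialgebras and weak Hopf algebras\<close>

locale bialgebra = vector_space sH
  for sH :: "'k::field \<Rightarrow> 'h::ring_1 \<Rightarrow> 'h" +
  fixes \<Delta> :: "'h \<Rightarrow> ('h \<Rightarrow> 'h \<Rightarrow> 'k) \<Rightarrow> 'k"
    and \<epsilon> :: "'h \<Rightarrow> 'k"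
  assumes mult_bilinear: "bilinear_map (full_space sH) (full_space sH) (full_space sH) (*)"
    and comult_linear: "linear_map (full_space sH)
      (tensor_space (full_space sH) (full_space sH)) \<Delta>"
    and counit_linear: "linear_map (full_space sH) scalars \<epsilon>"
    and coassoc:
      "tensor_sum (full_space sH) (full_space sH) (\<Delta> x) (\<lambda>y z.
         tensor_sum (full_space sH) (full_space sH) (\<Delta> y) (\<lambda>y' y''.
           pure_tensor (full_space sH) (tensor_space (full_space sH) (full_space sH))
             y' (pure_tensor (full_space sH) (full_space sH) y'' z)))
     = tensor_sum (full_space sH) (full_space sH) (\<Delta> x) (\<lambda>y z.
         pure_tensor (full_space sH) (tensor_space (full_space sH) (full_space sH)) y (\<Delta> z))"
    and counit_left: "tensor_sum (full_space sH) (full_space sH) (\<Delta> x) (\<lambda>x' x''. sH (\<epsilon> x') x'') = x"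
    and counit_right: "tensor_sum (full_space sH) (full_space sH) (\<Delta> x) (\<lambda>x' x''. sH (\<epsilon> x'') x') = x"
    and comult_mult:
      "\<Delta> (x * y) = tensor_sum (full_space sH) (full_space sH) (\<Delta> x) (\<lambda>x' x''.
         tensor_sum (full_space sH) (full_space sH) (\<Delta> y) (\<lambda>y' y''.
           pure_tensor (full_space sH) (full_space sH) (x' * y') (x'' * y'')))"
    and comult_one: "\<Delta> 1 = pure_tensor (full_space sH) (full_space sH) 1 1"
    and counit_mult: "\<epsilon> (x * y) = \<epsilon> x * \<epsilon> y"
    and counit_one: "\<epsilon> 1 = 1"
begin

abbreviation H :: "('k, 'h) vspace" where
  "H \<equiv> full_space sH"

definition sweedler :: "'h \<Rightarrow> ('h \<Rightarrow> 'h \<Rightarrow> 'w::monoid_add) \<Rightarrow> 'w" where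
  "sweedler x F = tensor_sum H H (\<Delta> x) F"

definition sweedler3 :: "'h \<Rightarrow> ('h \<Rightarrow> 'h \<Rightarrow> 'h \<Rightarrow> 'w::monoid_add) \<Rightarrow> 'w" where
  "sweedler3 x F = sweedler x (\<lambda>x' y. sweedler y (\<lambda>x'' x'''. F x' x'' x'''))"

definition convolution :: "('h \<Rightarrow> 'h) \<Rightarrow> ('h \<Rightarrow> 'h) \<Rightarrow> 'h \<Rightarrow> 'h" (infixl "\<star>" 70) where
  "(f \<star> g) x = sweedler x (\<lambda>x' x''. f x' * g x'')"

definition weak_antipode :: "('h \<Rightarrow> 'h) \<Rightarrow> bool" where
  "weak_antipode T \<longleftrightarrow> linear_map H H T \<and> id \<star> T \<star> id = id \<and> T \<star> id \<star> T = T"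

definition anti_bialgebra_morphism :: "('h \<Rightarrow> 'h) \<Rightarrow> bool" where
  "anti_bialgebra_morphism T \<longleftrightarrow> linear_map H H T \<and>
     (\<forall>x y. T (x * y) = T y * T x) \<and> T 1 = 1 \<and>
     (\<forall>x. \<Delta> (T x) = sweedler x (\<lambda>x' x''. pure_tensor H H (T x'') (T x'))) \<and>
     (\<forall>x. \<epsilon> (T x) = \<epsilon> x)"

definition perfect :: "('h \<Rightarrow> 'h) \<Rightarrow> bool" where
  "perfect T \<longleftrightarrow> anti_bialgebra_morphism T \<and> (\<forall>x y. (id \<star> T) x * y = y * (id \<star> T) x)"

definition coperfect :: "('h \<Rightarrow> 'h) \<Rightarrow> bool" where
  "coperfect T \<longleftrightarrow> anti_bialgebra_morphism T \<and>
     (\<forall>x. sweedler3 x (\<lambda>x' x'' x'''. pure_tensor H H (x' * T x'') x''')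
        = sweedler3 x (\<lambda>x' x'' x'''. pure_tensor H H (x'' * T x''') x'))"

definition crossed_bimodule ::
    "('k \<Rightarrow> 'v::ab_group_add \<Rightarrow> 'v) \<Rightarrow> ('h \<Rightarrow> 'v \<Rightarrow> 'v) \<Rightarrow> ('v \<Rightarrow> ('v \<Rightarrow> 'h \<Rightarrow> 'k) \<Rightarrow> 'k) \<Rightarrow> bool" where
  "crossed_bimodule sV \<mu> \<delta> \<longleftrightarrow> (let V = full_space sV in
     left_module H (*) 1 V \<mu> \<and> right_comodule H \<Delta> \<epsilon> V \<delta> \<and>
     (\<forall>a \<beta>. sweedler a (\<lambda>a' a''. tensor_sum V H (\<delta> \<beta>) (\<lambda>\<beta>\<^sub>V \<beta>\<^sub>H.
               pure_tensor V H (\<mu> a' \<beta>\<^sub>V) (a'' * \<beta>\<^sub>H)))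
          = sweedler a (\<lambda>a' a''. tensor_sum V H (\<delta> (\<mu> a'' \<beta>)) (\<lambda>\<gamma>\<^sub>V \<gamma>\<^sub>H.
               pure_tensor V H \<gamma>\<^sub>V (\<gamma>\<^sub>H * a')))))"

end

locale biperfect_weak_hopf_algebra = bialgebra sH \<Delta> \<epsilon>
  for sH :: "'k::field \<Rightarrow> 'h::ring_1 \<Rightarrow> 'h" and \<Delta> \<epsilon> +
  fixes T :: "'h \<Rightarrow> 'h"
  assumes weak_antipode: "weak_antipode T"
    and perfect: "perfect T"
    and coperfect: "coperfect T"
begin

definition twist_condition ::
    "('k \<Rightarrow> 'v::ab_group_add \<Rightarrow> 'v) \<Rightarrow> ('h \<Rightarrow> 'v \<Rightarrow> 'v) \<Rightarrow> ('v \<Rightarrow> ('v \<Rightarrow> 'h \<Rightarrow> 'k) \<Rightarrow> 'k) \<Rightarrow> bool" where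
  "twist_condition sV \<mu> \<delta> \<longleftrightarrow> (let V = full_space sV in
     \<forall>a \<beta>. sweedler3 a (\<lambda>a' a'' a'''. tensor_sum V H (\<delta> \<beta>) (\<lambda>\<beta>\<^sub>V \<beta>\<^sub>H.
             pure_tensor H V (inv T a''' * a'' * \<beta>\<^sub>H) (\<mu> a' \<beta>\<^sub>V)))
         = tensor_sum V H (\<delta> \<beta>) (\<lambda>\<beta>\<^sub>V \<beta>\<^sub>H. pure_tensor H V \<beta>\<^sub>H (\<mu> a \<beta>\<^sub>V)))"


section \<open>The quantum double\<close>

abbreviation H_dual :: "('k, 'h \<Rightarrow> 'k) vspace" where
  "H_dual \<equiv> dual_space sH"

definition dual_mult :: "('h \<Rightarrow> 'k) \<Rightarrow> ('h \<Rightarrow> 'k) \<Rightarrow> 'h \<Rightarrow> 'k" where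
  "dual_mult f g = (\<lambda>a. sweedler a (\<lambda>a' a''. f a' * g a''))"

text \<open>The comultiplication of the dual is opposite to the transpose of the multiplication.
  It exists and is unique when \<open>H\<close> is finite dimensional.\<close>

definition dual_comult :: "('h \<Rightarrow> 'k) \<Rightarrow> (('h \<Rightarrow> 'k) \<Rightarrow> ('h \<Rightarrow> 'k) \<Rightarrow> 'k) \<Rightarrow> 'k" where
  "dual_comult f = (THE t. t \<in> vecs (tensor_space H_dual H_dual) \<and>
     (\<forall>a b. tensor_sum H_dual H_dual t (\<lambda>f' f''. f' a * f'' b) = f (b * a)))"

definition dual_sweedler :: "('h \<Rightarrow> 'k) \<Rightarrow> (('h \<Rightarrow> 'k) \<Rightarrow> ('h \<Rightarrow> 'k) \<Rightarrow> 'w::monoid_add) \<Rightarrow> 'w" where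
  "dual_sweedler f F = tensor_sum H_dual H_dual (dual_comult f) F"

definition dual_sweedler3 ::
    "('h \<Rightarrow> 'k) \<Rightarrow> (('h \<Rightarrow> 'k) \<Rightarrow> ('h \<Rightarrow> 'k) \<Rightarrow> ('h \<Rightarrow> 'k) \<Rightarrow> 'w::monoid_add) \<Rightarrow> 'w" where
  "dual_sweedler3 f F = dual_sweedler f (\<lambda>f' g. dual_sweedler g (\<lambda>f'' f'''. F f' f'' f'''))"

definition act_on_dual :: "'h \<Rightarrow> ('h \<Rightarrow> 'k) \<Rightarrow> 'h \<Rightarrow> 'k" (infixr "\<rhd>" 75) where
  "a \<rhd> f = dual_sweedler3 f (\<lambda>f' f'' f'''. smul H_dual (dual_mult f' (f''' \<circ> inv T) a) f'')"

definition acted_by_dual :: "'h \<Rightarrow> ('h \<Rightarrow> 'k) \<Rightarrow> 'h" (infixl "\<lhd>" 75) where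
  "a \<lhd> f = sweedler3 a (\<lambda>a' a'' a'''. sH (f (inv T a''' * a')) a'')"

text \<open>Only the algebra structure of the quantum double enters the notion of a module, so its
  comultiplication and counit are not needed.\<close>

definition double :: "('k, (('h \<Rightarrow> 'k) \<Rightarrow> 'h \<Rightarrow> 'k) \<Rightarrow> 'k) vspace" where
  "double = tensor_space H_dual H"

definition double_one :: "(('h \<Rightarrow> 'k) \<Rightarrow> 'h \<Rightarrow> 'k) \<Rightarrow> 'k" where
  "double_one = pure_tensor H_dual H \<epsilon> 1"

definition double_mult ::
    "((('h \<Rightarrow> 'k) \<Rightarrow> 'h \<Rightarrow> 'k) \<Rightarrow> 'k) \<Rightarrow> ((('h \<Rightarrow> 'k) \<Rightarrow> 'h \<Rightarrow> 'k) \<Rightarrow> 'k) \<Rightarrow>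
     (('h \<Rightarrow> 'k) \<Rightarrow> 'h \<Rightarrow> 'k) \<Rightarrow> 'k" where
  "double_mult x y = tensor_sum H_dual H x (\<lambda>f a. tensor_sum H_dual H y (\<lambda>g b.
     sweedler a (\<lambda>a' a''. dual_sweedler g (\<lambda>g' g''.
       pure_tensor H_dual H (dual_mult f (a' \<rhd> g')) ((a'' \<lhd> g'') * b)))))"

definition double_module ::
    "('k \<Rightarrow> 'v::ab_group_add \<Rightarrow> 'v) \<Rightarrow> (((('h \<Rightarrow> 'k) \<Rightarrow> 'h \<Rightarrow> 'k) \<Rightarrow> 'k) \<Rightarrow> 'v \<Rightarrow> 'v) \<Rightarrow> bool" where
  "double_module sV act \<longleftrightarrow> left_module double double_mult double_one (full_space sV) act"

text \<open>The action of the quantum double attached to an action and a coaction of \<open>H\<close>: the factor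
  \<open>H\<close> acts through \<open>\<mu>\<close> and the dual acts by \<open>f \<beta> = f(\<beta>\<^sub>H) \<beta>\<^sub>V\<close>. Its value outside
  of the carrier of the quantum double is fixed by \<open>restrict\<close>.\<close>

definition double_action ::
    "('k \<Rightarrow> 'v::ab_group_add \<Rightarrow> 'v) \<Rightarrow> ('h \<Rightarrow> 'v \<Rightarrow> 'v) \<Rightarrow> ('v \<Rightarrow> ('v \<Rightarrow> 'h \<Rightarrow> 'k) \<Rightarrow> 'k) \<Rightarrow>
     ((('h \<Rightarrow> 'k) \<Rightarrow> 'h \<Rightarrow> 'k) \<Rightarrow> 'k) \<Rightarrow> 'v \<Rightarrow> 'v" where
  "double_action sV \<mu> \<delta> = restrict (\<lambda>x \<beta>. tensor_sum H_dual H x (\<lambda>f a.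
     tensor_sum (full_space sV) H (\<delta> (\<mu> a \<beta>)) (\<lambda>\<gamma>\<^sub>V \<gamma>\<^sub>H. sV (f \<gamma>\<^sub>H) \<gamma>\<^sub>V))) (vecs double)"

end

end

theory Submission
  imports Defs
begin

text \<open>Write \<open>S\<close> for the inverse of the weak antipode. The product of the quantum double simplifies to
  \<open>(f \<infinity> a)(g \<infinity> b) = \<Sum> f \<cdot> g(S(a''') \<hyphen> a') \<infinity> a'' b\<close>, because \<open>d(x) = x'' S(x')\<close> is central
  (\<open>H\<close> is perfect) and \<open>d(x'') x' = x\<close>. A comodule over \<open>H\<close> is the same as a module over the dual
  algebra, so a module over the double is an action and a coaction of \<open>H\<close> such that
  \<open>\<Sum> a \<beta>\<^sub>V \<otimes> \<beta>\<^sub>H = \<Sum> (a'' \<beta>)\<^sub>V \<otimes> S(a''') (a'' \<beta>)\<^sub>H a'\<close>.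
  Multiplying the second factor by a further Sweedler component of \<open>a\<close> turns this into the
  compatibility condition of a crossed bimodule, since \<open>d\<close> is central and
  \<open>d(x') \<otimes> x'' = d(x'') \<otimes> x'\<close> (\<open>H\<close> is coperfect). Multiplying by \<open>S(a''') a''\<close> gives the twist
  condition, since \<open>S(x''') x'' S(x') = S(x)\<close>. Conversely the two conditions together give the
  identity. Identities between tensors are tested on scalar bilinear forms.\<close>

section \<open>Tensors as functionals on bilinear forms\<close>

text \<open>In a Hopf algebra \<open>d x\<close> would be \<open>\<epsilon> x\<close> times 1. Here
  that is lost, and each fact about \<open>d\<close> is an axiom for \<open>T\<close> transported by
  the anti-automorphism \<open>S\<close>. Centrality comes from perfectness and the flip from
  coperfectness. The contraction \<open>d(x'') x' = x\<close> is
  \<open>T \<star> id \<star> T = T\<close> under \<open>S\<close>, while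
  \<open>S(x''') x'' S(x') = S(x)\<close> is \<open>id \<star> T \<star> id = id\<close> read at
  \<open>S x\<close>. The obstacle is that \<open>tensor_sum\<close> runs over a list picked by
  choice. Additive maps and other sums pass through it whatever the summand. Every step that changes
  the tensor itself (linearity in it, coassociativity, the coproduct of \<open>S x\<close>, the
  value at a pure tensor) costs a proof that the summand is multilinear. With scalar test forms the
  simplifier can give such proofs, and no information is lost because functionals separate vectors
  over a field. Finite dimension enters through the canonical element, the sum of
  \<open>coord b\<close> \<otimes> \<open>b\<close>. It yields the coproduct of the dual, turns
  functional-valued expressions into scalars, and rebuilds a coaction from an action of the
  dual.\<close>

definition lin :: "('k::field \<Rightarrow> 'u::ab_group_add \<Rightarrow> 'u) \<Rightarrow> ('u \<Rightarrow> 'k) \<Rightarrow> bool" where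
  "lin s f \<longleftrightarrow> (\<forall>x y. f (x + y) = f x + f y) \<and> (\<forall>c x. f (s c x) = c * f x)"

lemma linear_map_full_iff: "linear_map (full_space s) scalars f \<longleftrightarrow> lin s f"
  by (auto simp: linear_map_def full_space_def lin_def)

lemma bilinear_map_full_iff:
  "bilinear_map (full_space s) (full_space s') scalars F \<longleftrightarrow>
     (\<forall>u. lin s' (F u)) \<and> (\<forall>v. lin s (\<lambda>u. F u v))"
  by (simp add: bilinear_map_def linear_map_full_iff) (simp add: full_space_def)

lemma vecs_full_space [simp]: "vecs (full_space s) = UNIV"
  and smul_full_space [simp]: "smul (full_space s) = s"
  by (simp_all add: full_space_def)

lemma vecs_dual_space: "f \<in> vecs (dual_space s) \<longleftrightarrow> lin s f"
  by (simp add: dual_space_def linear_map_full_iff)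

lemma smul_dual_space: "smul (dual_space s) c f = (\<lambda>x. c * f x)"
  by (simp add: dual_space_def)

lemma lin_add: "lin s f \<Longrightarrow> f (x + y) = f x + f y"
  and lin_scale: "lin s f \<Longrightarrow> f (s c x) = c * f x"
  by (auto simp: lin_def)

lemma lin_zero: "lin s f \<Longrightarrow> f 0 = 0"
  using lin_add[of s f 0 0] by (metis add_0_right add_left_cancel)

lemma lin_sum: "lin s f \<Longrightarrow> f (\<Sum>i\<in>I. g i) = (\<Sum>i\<in>I. f (g i))"
  by (induction I rule: infinite_finite_induct) (auto simp: lin_zero lin_add)

text \<open>Linear functionals separate the vectors of a space over a field. This reduces
  vector-valued identities to scalar ones, where the Sweedler rules apply.\<close>

lemma vector_eqI:
  assumes "vector_space s" "\<And>f. lin s f \<Longrightarrow> f x = f y"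
  shows "x = y"
proof (rule ccontr)
  assume "x \<noteq> y"
  hence "x - y \<noteq> 0" by simp
  from linear_functional_separates[OF assms(1) this] obtain f
    where f: "lin s f" "f (x - y) \<noteq> 0" unfolding linear_map_full_iff by blast
  have "f x = f (x - y) + f y" using lin_add[OF f(1), of "x - y" y] by simp
  with f(2) assms(2)[OF f(1)] show False by simp
qed

lemma is_vspace_scalars: "is_vspace (scalars :: ('k::field, 'k) vspace)"
  unfolding is_vspace_def
proof
  show "vector_space (smul (scalars :: ('k, 'k) vspace))"
    by unfold_locales (simp_all add: algebra_simps)
  then interpret vector_space "smul (scalars :: ('k, 'k) vspace)" .
  show "subspace (vecs (scalars :: ('k, 'k) vspace))"
    by (simp add: subspace_UNIV del: smul_full_space)
qed

lemma is_vspace_full_space: "vector_space s \<Longrightarrow> is_vspace (full_space s)"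
  by (simp add: is_vspace_def module.subspace_UNIV module_iff_vector_space)

lemma is_vspace_dual_space: "is_vspace (dual_space (s :: 'k::field \<Rightarrow> 'u::ab_group_add \<Rightarrow> 'u))"
  unfolding is_vspace_def
proof
  show "vector_space (smul (dual_space s))"
    by unfold_locales (simp_all add: smul_dual_space algebra_simps fun_eq_iff)
  then interpret vector_space "smul (dual_space s)" .
  show "subspace (vecs (dual_space s))"
    by (auto simp: subspace_def vecs_dual_space smul_dual_space lin_def algebra_simps)
qed

section \<open>Rules for Sweedler sums over a chosen representation\<close>

lemma tensor_sum_induct:
  assumes "P 0" "\<And>u v w. P w \<Longrightarrow> P (F u v + w)"
  shows "P (tensor_sum A B t F)"
proof -
  have "P (\<Sum>(u, v)\<leftarrow>xs. F u v)" for xs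
    by (induction xs) (auto simp: assms)
  thus ?thesis by (simp add: tensor_sum_def)
qed

text \<open>The list of pure tensors depends on \<open>t\<close> alone, so both sides sum over the
  same list. Hence neither bilinearity of \<open>F\<close> nor membership of \<open>t\<close>
  occurs.\<close>

lemma tensor_sum_hom:
  assumes "h 0 = 0" "\<And>x y. h (x + y) = h x + h y"
  shows "h (tensor_sum A B t F) = tensor_sum A B t (\<lambda>u v. h (F u v))"
proof -
  have "h (\<Sum>(u, v)\<leftarrow>xs. F u v) = (\<Sum>(u, v)\<leftarrow>xs. h (F u v))" for xs
    by (induction xs) (auto simp: assms)
  thus ?thesis by (simp add: tensor_sum_def)
qed

lemma tensor_sum_zero [simp]: "tensor_sum A B t (\<lambda>u v. 0) = 0"
  by (rule tensor_sum_induct) auto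

lemma tensor_sum_add:
  "tensor_sum A B t (\<lambda>u v. F u v + G u v) = tensor_sum A B t F + (tensor_sum A B t G :: 'w::comm_monoid_add)"
proof -
  have "(\<Sum>(u, v)\<leftarrow>xs. F u v + G u v) = (\<Sum>(u, v)\<leftarrow>xs. F u v) + (\<Sum>(u, v)\<leftarrow>xs. G u v)" for xs
    by (induction xs) (auto simp: ac_simps)
  thus ?thesis by (simp add: tensor_sum_def)
qed

lemma tensor_sum_mult_left:
  "tensor_sum A B t (\<lambda>u v. c * F u v) = (c :: 'w::ring) * tensor_sum A B t F"
  by (rule tensor_sum_hom[symmetric]) (simp_all add: distrib_left)

lemma tensor_sum_mult_right:
  "tensor_sum A B t (\<lambda>u v. F u v * c) = tensor_sum A B t F * (c :: 'w::ring)"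
  by (rule tensor_sum_hom[where h = "\<lambda>x. x * c", symmetric]) (simp_all add: distrib_right)

lemma tensor_sum_sum:
  "tensor_sum A B t (\<lambda>u v. \<Sum>i\<in>I. F i u v) =
   (\<Sum>i\<in>I. tensor_sum A B t (\<lambda>u v. F i u v) :: 'w::comm_monoid_add)"
  by (induction I rule: infinite_finite_induct) (auto simp: tensor_sum_add)

text \<open>Both lists are fixed in advance, since neither tensor depends on the variables of the
  other sum. This is an exchange of two finite sums.\<close>

lemma tensor_sum_swap:
  "tensor_sum A B t (\<lambda>u v. tensor_sum C D t' (\<lambda>x y. F u v x y)) =
   tensor_sum C D t' (\<lambda>x y. tensor_sum A B t (\<lambda>u v. F u v x y :: 'w::comm_monoid_add))"
proof -
  have "(\<Sum>(u, v)\<leftarrow>xs. tensor_sum C D t' (\<lambda>x y. F u v x y)) =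
      tensor_sum C D t' (\<lambda>x y. \<Sum>(u, v)\<leftarrow>xs. F u v x y)" for xs
    by (induction xs) (auto simp: tensor_sum_add)
  thus ?thesis by (simp add: tensor_sum_def[of A B])
qed

lemma tensor_sum_fun_apply:
  "tensor_sum A B t G F = tensor_sum A B t (\<lambda>u v. (G u v F :: 'k::comm_monoid_add))"
  by (simp add: tensor_sum_def sum_list_tensor_apply)

text \<open>Membership of \<open>t\<close> guarantees that the chosen list really represents
  \<open>t\<close>, so that its entries lie in the carriers.\<close>

lemma tensor_sum_cong:
  assumes "t \<in> vecs (tensor_space A B)"
    and "\<And>u v. u \<in> vecs A \<Longrightarrow> v \<in> vecs B \<Longrightarrow> F u v = G u v"
  shows "tensor_sum A B t F = tensor_sum A B t G"
proof -
  have "represents A B (SOME xs. represents A B xs t) t"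
    using assms(1) by (auto simp: tensor_space_def intro: someI)
  hence *: "set (SOME xs. represents A B xs t) \<subseteq> vecs A \<times> vecs B" by (simp add: represents_def)
  show ?thesis unfolding tensor_sum_def
    by (rule arg_cong[of _ _ sum_list], rule map_cong) (use * in \<open>auto simp: assms(2)\<close>)
qed

text \<open>The bridge between the two readings of a tensor: evaluation at \<open>F\<close> is
  visibly linear in \<open>t\<close>, whereas the sum can be manipulated termwise.\<close>

lemma tensor_apply:
  assumes "bilinear_map A B scalars F" "t \<in> vecs (tensor_space A B)"
  shows "t F = tensor_sum A B t F"
proof -
  have "represents A B (SOME xs. represents A B xs t) t"
    using assms(2) by (auto simp: tensor_space_def intro: someI)
  hence "t F = (\<Sum>(u, v)\<leftarrow>(SOME xs. represents A B xs t). pure_tensor A B u v) F"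
    by (simp add: represents_def)
  thus ?thesis using assms(1)
    by (simp add: tensor_sum_def sum_list_tensor_apply pure_tensor_def)
qed

lemma tensor_apply_not_bilinear:
  assumes "\<not> bilinear_map A B scalars F" "t \<in> vecs (tensor_space A B)"
  shows "t F = 0"
proof -
  obtain xs where "represents A B xs t"
    using assms(2) by (auto simp: tensor_space_def)
  hence "t F = (\<Sum>(u, v)\<leftarrow>xs. pure_tensor A B u v) F"
    by (simp add: represents_def)
  thus ?thesis using assms(1)
    by (simp only: sum_list_tensor_apply) (simp add: pure_tensor_def case_prod_unfold)
qed

text \<open>The default value 0 of \<open>pure_tensor\<close> makes all tensors agree off the
  bilinear forms, so bilinear tests decide equality of functions.\<close>

lemma tensor_eqI:
  assumes "t \<in> vecs (tensor_space A B)" "t' \<in> vecs (tensor_space A B)"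
    and "\<And>F. bilinear_map A B scalars F \<Longrightarrow> t F = t' F"
  shows "t = t'"
  using assms tensor_apply_not_bilinear by (metis ext)

lemma pure_tensor_mem:
  "\<lbrakk>u \<in> vecs A; v \<in> vecs B\<rbrakk> \<Longrightarrow> pure_tensor A B u v \<in> vecs (tensor_space A B)"
  by (auto simp: tensor_space_def represents_def intro!: exI[of _ "[(u, v)]"])

lemma pure_tensor_add_left:
  "\<lbrakk>u \<in> vecs A; u' \<in> vecs A; v \<in> vecs B\<rbrakk> \<Longrightarrow>
   pure_tensor A B (u + u') v = pure_tensor A B u v + pure_tensor A B u' v"
  and pure_tensor_add_right:
  "\<lbrakk>u \<in> vecs A; v \<in> vecs B; v' \<in> vecs B\<rbrakk> \<Longrightarrow>
   pure_tensor A B u (v + v') = pure_tensor A B u v + pure_tensor A B u v'"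
  and pure_tensor_scale_left:
  "\<lbrakk>u \<in> vecs A; v \<in> vecs B\<rbrakk> \<Longrightarrow>
   pure_tensor A B (smul A c u) v = smul (tensor_space A B) c (pure_tensor A B u v)"
  and pure_tensor_scale_right:
  "\<lbrakk>u \<in> vecs A; v \<in> vecs B\<rbrakk> \<Longrightarrow>
   pure_tensor A B u (smul B c v) = smul (tensor_space A B) c (pure_tensor A B u v)"
  by (auto simp: pure_tensor_def bilinear_map_def linear_map_def tensor_space_def fun_eq_iff)

lemma tensor_space_zero: "0 \<in> vecs (tensor_space A B)"
  by (auto simp: tensor_space_def represents_def intro!: exI[of _ "[]"])

lemma tensor_space_add:
  assumes "t \<in> vecs (tensor_space A B)" "t' \<in> vecs (tensor_space A B)"
  shows "t + t' \<in> vecs (tensor_space A B)"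
proof -
  obtain xs ys where "represents A B xs t" "represents A B ys t'"
    using assms by (auto simp: tensor_space_def)
  hence "represents A B (xs @ ys) (t + t')" by (auto simp: represents_def)
  thus ?thesis by (auto simp: tensor_space_def)
qed

lemma tensor_space_sum:
  "(\<And>i. i \<in> I \<Longrightarrow> g i \<in> vecs (tensor_space A B)) \<Longrightarrow> (\<Sum>i\<in>I. g i) \<in> vecs (tensor_space A B)"
  by (induction I rule: infinite_finite_induct)
    (auto simp: tensor_space_zero tensor_space_add)

lemma tensor_sum_mem:
  assumes "t \<in> vecs (tensor_space A B)"
    and "\<And>u v. u \<in> vecs A \<Longrightarrow> v \<in> vecs B \<Longrightarrow> F u v \<in> vecs (tensor_space C D)"
  shows "tensor_sum A B t F \<in> vecs (tensor_space C D)"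
proof -
  \<comment> \<open>\<open>tensor_sum_induct\<close> quantifies over all \<open>u\<close> and
    \<open>v\<close>, so the summand is replaced by 0 outside the carriers.\<close>
  let ?F = "\<lambda>u v. if u \<in> vecs A \<and> v \<in> vecs B then F u v else 0"
  have "tensor_sum A B t F = tensor_sum A B t ?F"
    by (rule tensor_sum_cong[OF assms(1)]) simp
  also have "\<dots> \<in> vecs (tensor_space C D)"
    proof (rule tensor_sum_induct[where P = "\<lambda>w. w \<in> vecs (tensor_space C D)"])
    show "0 \<in> vecs (tensor_space C D)" by (rule tensor_space_zero)
  next
    fix u v w assume "w \<in> vecs (tensor_space C D)"
    thus "?F u v + w \<in> vecs (tensor_space C D)"
      by (cases "u \<in> vecs A \<and> v \<in> vecs B") (auto intro: tensor_space_add assms(2))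
  qed
  finally show ?thesis .
qed

lemma tensor_space_scale:
  assumes A: "is_vspace A" and t: "t \<in> vecs (tensor_space A B)"
  shows "smul (tensor_space A B) c t \<in> vecs (tensor_space A B)"
proof -
  interpret module "smul A" using A by (simp add: is_vspace_def module_iff_vector_space)
  have mem: "u \<in> vecs A \<Longrightarrow> smul A c u \<in> vecs A" for u
    using A by (simp add: is_vspace_def subspace_scale)
  let ?t = "tensor_sum A B t (\<lambda>u v. pure_tensor A B (smul A c u) v)"
  have "smul (tensor_space A B) c t = ?t"
  proof
    fix F
    show "smul (tensor_space A B) c t F = ?t F"
    proof (cases "bilinear_map A B scalars F")
      case True
      have "?t F = tensor_sum A B t (\<lambda>u v. F (smul A c u) v)"
        using True by (simp add: tensor_sum_fun_apply pure_tensor_def)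
      also have "\<dots> = tensor_sum A B t (\<lambda>u v. c * F u v)"
        using True by (intro tensor_sum_cong[OF t]) (auto simp: bilinear_map_def linear_map_def)
      finally show ?thesis
        using tensor_apply[OF True t] by (simp add: tensor_space_def tensor_sum_mult_left)
    next
      case False
      from tensor_apply_not_bilinear[OF this t] False show ?thesis
        by (simp add: tensor_sum_fun_apply tensor_space_def) (simp add: pure_tensor_def)
    qed
  qed
  moreover have "?t \<in> vecs (tensor_space A B)"
    by (intro tensor_sum_mem t pure_tensor_mem mem)
  ultimately show ?thesis by simp
qed

lemma sum_fun_apply: "(\<Sum>i\<in>I. g i) x = (\<Sum>i\<in>I. g i x :: 'k::comm_monoid_add)"
  by (induction I rule: infinite_finite_induct) auto

text \<open>\<open>h\<close> is additive on the carrier only, so \<open>tensor_sum_hom\<close> does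
  not apply. The induction over the list carries along that each partial sum is a tensor.\<close>

lemma linear_on_tensor:
  assumes "linear_map (tensor_space A B) scalars h"
    and "t \<in> vecs (tensor_space A B)"
  shows "h t = tensor_sum A B t (\<lambda>u v. h (pure_tensor A B u v))"
proof -
  have h0: "h 0 = 0"
    using assms(1) tensor_space_zero[of A B] unfolding linear_map_def
    by (metis add_cancel_left_left add_0_left)
  have "set xs \<subseteq> vecs A \<times> vecs B \<Longrightarrow> (\<Sum>(u, v)\<leftarrow>xs. pure_tensor A B u v) \<in> vecs (tensor_space A B)
     \<and> h (\<Sum>(u, v)\<leftarrow>xs. pure_tensor A B u v) = (\<Sum>(u, v)\<leftarrow>xs. h (pure_tensor A B u v))" for xs
  proof (induction xs)
    case Nil
    show ?case using h0 tensor_space_zero[of A B] by (simp add: zero_fun_def)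
  next
    case (Cons p xs)
    obtain u v where p: "p = (u, v)" by (cases p)
    let ?t = "\<Sum>(u, v)\<leftarrow>xs. pure_tensor A B u v"
    have u: "pure_tensor A B u v \<in> vecs (tensor_space A B)"
      using Cons.prems by (simp add: p pure_tensor_mem)
    have t: "?t \<in> vecs (tensor_space A B)" "h ?t = (\<Sum>(u, v)\<leftarrow>xs. h (pure_tensor A B u v))"
      using Cons by auto
    have "h (pure_tensor A B u v + ?t) = h (pure_tensor A B u v) + h ?t"
      using assms(1) u t(1) unfolding linear_map_def by blast
    then show ?case
      using tensor_space_add[OF u t(1)] by (simp only: p list.map sum_list.Cons case_prod_conv t(2) simp_thms)
  qed
  note * = this
  have r: "represents A B (SOME xs. represents A B xs t) t" (is "represents A B ?xs t")
    using assms(2) by (auto simp: tensor_space_def intro: someI)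
  have "h t = h (\<Sum>(u, v)\<leftarrow>?xs. pure_tensor A B u v)"
    using r unfolding represents_def by (intro arg_cong[where f = h]) (rule conjunct2)
  also have "\<dots> = (\<Sum>(u, v)\<leftarrow>?xs. h (pure_tensor A B u v))"
    using r by (intro conjunct2[OF *]) (simp add: represents_def)
  finally show ?thesis unfolding tensor_sum_def .
qed

section \<open>Sweedler calculus in a biperfect weak Hopf algebra\<close>

context bialgebra
begin

lemma mult_scale: "x * sH c y = sH c (x * y)" "sH c x * y = sH c (x * y)"
  using mult_bilinear by (auto simp: bilinear_map_def linear_map_def)

lemma lin_counit: "lin sH \<epsilon>"
  using counit_linear by (simp add: linear_map_full_iff)

lemma comult_mem: "\<Delta> x \<in> vecs (tensor_space H H)"
  using comult_linear by (simp add: linear_map_def)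

lemma sweedler_eq_apply: "bilinear_map H H scalars F \<Longrightarrow> sweedler x F = \<Delta> x F"
  by (simp add: sweedler_def tensor_apply comult_mem)

lemma lin_sweedler:
  assumes "bilinear_map H H scalars F"
  shows "lin sH (\<lambda>x. sweedler x F)"
  using comult_linear unfolding sweedler_eq_apply[OF assms]
  by (simp add: lin_def linear_map_def tensor_space_def)

lemma sweedler_add_left:
  "bilinear_map H H scalars F \<Longrightarrow> sweedler (x + y) F = sweedler x F + sweedler y F"
  by (rule lin_add[OF lin_sweedler])

lemma sweedler_scale_left:
  "bilinear_map H H scalars F \<Longrightarrow> sweedler (sH c x) F = c * sweedler x F"
  by (rule lin_scale[OF lin_sweedler])

lemma sweedler_lin: "lin s f \<Longrightarrow> f (sweedler x F) = sweedler x (\<lambda>u v. f (F u v))"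
  unfolding sweedler_def by (rule tensor_sum_hom) (auto simp: lin_zero lin_add)

lemmas sweedler_add = tensor_sum_add[where A = "H" and B = "H" and t = "\<Delta> x" for x, folded sweedler_def]
lemmas sweedler_mult_left = tensor_sum_mult_left[where A = "H" and B = "H" and t = "\<Delta> x" for x, folded sweedler_def]
lemmas sweedler_mult_right = tensor_sum_mult_right[where A = "H" and B = "H" and t = "\<Delta> x" for x, folded sweedler_def]
lemmas sweedler_fun_apply = tensor_sum_fun_apply[where A = "H" and B = "H" and t = "\<Delta> x" for x, folded sweedler_def]
lemmas sweedler_swap = tensor_sum_swap[where A = "H" and B = "H" and t = "\<Delta> x"
    and C = "H" and D = "H" and t' = "\<Delta> y" for x y, folded sweedler_def]
lemmas sweedler_tensor_swap = tensor_sum_swap[where A = "H" and B = "H" and t = "\<Delta> x" for x, folded sweedler_def]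
lemmas sweedler_sum = tensor_sum_sum[where A = "H" and B = "H" and t = "\<Delta> x" for x, folded sweedler_def]

lemma sweedler_cong: "(\<And>u v. F u v = G u v) \<Longrightarrow> sweedler x F = sweedler x G"
  by presburger

lemma sweedler_zero [simp]: "sweedler x (\<lambda>u v. 0) = 0"
  by (simp add: sweedler_def)

lemma sweedler_coassoc:
  fixes F :: "'h \<Rightarrow> 'h \<Rightarrow> 'h \<Rightarrow> 'k"
  assumes "\<And>y z. lin sH (\<lambda>x. F x y z)" "\<And>x z. lin sH (\<lambda>y. F x y z)" "\<And>x y. lin sH (\<lambda>z. F x y z)"
  shows "sweedler x (\<lambda>u z. sweedler u (\<lambda>x y. F x y z)) = sweedler x (\<lambda>x u. sweedler u (\<lambda>y z. F x y z))"
proof -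
  have bF: "bilinear_map H H scalars (F x)" for x
    using assms by (simp add: bilinear_map_full_iff)
  \<comment> \<open>The axiom \<open>coassoc\<close> compares tensors in H \<otimes> (H \<otimes>
    H). \<open>G\<close> is the bilinear form on H and H \<otimes> H induced by the trilinear
    \<open>F\<close>; evaluating the axiom at \<open>G\<close> gives the claim.\<close>
  define G where "G = (\<lambda>u (w :: ('h \<Rightarrow> 'h \<Rightarrow> 'k) \<Rightarrow> 'k). tensor_sum H H w (F u))"
  have Gt: "tensor_sum H H w (F u) = w (F u)" if "w \<in> vecs (tensor_space H H)" for u w
    using tensor_apply[OF bF that] by simp
  have "bilinear_map H (tensor_space H H) scalars G"
    unfolding bilinear_map_def
  proof (intro conjI ballI)
    fix u show "linear_map (tensor_space H H) scalars (G u)"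
      unfolding G_def by (rule tensor_universal(1)) (simp_all add: is_vspace_scalars bF is_vspace_full_space vector_space_axioms)
  next
    fix w assume "w \<in> vecs (tensor_space H H)"
    show "linear_map H scalars (\<lambda>u. G u w)"
    proof -
      have "F (x + x') = (\<lambda>y z. F x y z + F x' y z)" "F (sH c x) = (\<lambda>y z. c * F x y z)" for x x' c
        using assms(1) by (auto simp: lin_def fun_eq_iff)
      thus ?thesis unfolding linear_map_full_iff G_def
        by (simp add: lin_def tensor_sum_add tensor_sum_mult_left)
    qed
  qed
  note G = this
  have G_pure: "G x (pure_tensor H H y z) = F x y z" for x y z
    unfolding G_def by (simp add: Gt pure_tensor_mem) (simp add: pure_tensor_def bF)
  have G_comult: "G y (\<Delta> z) = sweedler z (F y)" for y z
    by (simp add: G_def sweedler_def)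
  have "tensor_sum H H (\<Delta> x) (\<lambda>y z.
         tensor_sum H H (\<Delta> y) (\<lambda>y' y''. pure_tensor H (tensor_space H H)
             y' (pure_tensor H H y'' z))) G
     = tensor_sum H H (\<Delta> x) (\<lambda>y z. pure_tensor H (tensor_space H H) y (\<Delta> z)) G"
    using coassoc[of x] by simp
  thus ?thesis
    unfolding tensor_sum_fun_apply pure_tensor_def[of _ "tensor_space H H"]
    by (simp add: G G_pure G_comult sweedler_def)
qed

lemma sweedler3_tensor_eq_iff:
  fixes F G :: "'h \<Rightarrow> 'h \<Rightarrow> 'h \<Rightarrow> 'u::ab_group_add" and F' G' :: "'h \<Rightarrow> 'h \<Rightarrow> 'h \<Rightarrow> 'w::ab_group_add"
  shows "sweedler3 x (\<lambda>a b c. pure_tensor A B (F a b c) (F' a b c)) =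
    sweedler3 x (\<lambda>a b c. pure_tensor A B (G a b c) (G' a b c)) \<longleftrightarrow>
   (\<forall>K. bilinear_map A B scalars K \<longrightarrow>
     sweedler x (\<lambda>a u. sweedler u (\<lambda>b c. K (F a b c) (F' a b c))) =
     sweedler x (\<lambda>a u. sweedler u (\<lambda>b c. K (G a b c) (G' a b c))))"
  unfolding fun_eq_iff sweedler3_def sweedler_fun_apply
proof (rule iff_allI)
  fix K show "sweedler x (\<lambda>a u. sweedler u (\<lambda>b c. pure_tensor A B (F a b c) (F' a b c) K)) =
      sweedler x (\<lambda>a u. sweedler u (\<lambda>b c. pure_tensor A B (G a b c) (G' a b c) K)) \<longleftrightarrow>
     (bilinear_map A B scalars K \<longrightarrow>
       sweedler x (\<lambda>a u. sweedler u (\<lambda>b c. K (F a b c) (F' a b c))) =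
       sweedler x (\<lambda>a u. sweedler u (\<lambda>b c. K (G a b c) (G' a b c))))"
    by (cases "bilinear_map A B scalars K") (simp_all add: pure_tensor_def)
qed

end

section \<open>The inverse antipode and the central element\<close>

locale fd_biperfect = biperfect_weak_hopf_algebra sH \<Delta> \<epsilon> T
  for sH :: "'k::field \<Rightarrow> 'h::ring_1 \<Rightarrow> 'h" and \<Delta> \<epsilon> T +
  assumes fin: "\<exists>B. finite B \<and> module.span sH B = UNIV" and bij_T: "bij T"
begin

abbreviation S where "S \<equiv> inv T"

lemma ST [simp]: "S (T x) = x" and TS [simp]: "T (S x) = x"
  using bij_T by (simp_all add: bij_is_inj bij_is_surj surj_f_inv_f)

lemma T_eq_iff: "T x = T y \<longleftrightarrow> x = y"
  using bij_T by (simp add: bij_is_inj inj_eq)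

lemma T_add: "T (x + y) = T x + T y" and T_scale: "T (sH c x) = sH c (T x)"
  and T_mult: "T (x * y) = T y * T x" and T_one: "T 1 = 1"
  using perfect by (auto simp: perfect_def anti_bialgebra_morphism_def linear_map_def)

lemma S_add: "S (x + y) = S x + S y" and S_scale: "S (sH c x) = sH c (S x)"
  and S_mult: "S (x * y) = S y * S x" and S_one: "S 1 = 1"
  by (rule T_eq_iff[THEN iffD1], simp add: T_add T_scale T_mult T_one)+

text \<open>Proves multilinearity of nested Sweedler expressions by simplification:
  \<open>sweedler_add_left\<close> and \<open>sweedler_scale_left\<close> raise bilinearity
  conditions, which the same rules discharge one level deeper.\<close>

lemmas lin_simps = lin_def bilinear_map_full_iff mult_scale S_add S_scale T_add T_scale
  distrib_left distrib_right scale_right_distrib sweedler_add sweedler_mult_left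
  sweedler_mult_right sweedler_add_left sweedler_scale_left

lemma sweedler_T:
  assumes "bilinear_map H H scalars F"
  shows "sweedler (T x) F = sweedler x (\<lambda>u v. F (T v) (T u))"
proof -
  have "\<Delta> (T x) = sweedler x (\<lambda>x' x''. pure_tensor H H (T x'') (T x'))"
    using perfect by (simp add: perfect_def anti_bialgebra_morphism_def)
  thus ?thesis unfolding sweedler_eq_apply[OF assms]
    by (simp add: sweedler_fun_apply) (simp add: pure_tensor_def assms)
qed

text \<open>The rule for \<open>T\<close>, taken at the element \<open>S x\<close> and for the form
  composed with \<open>S\<close> in both arguments.\<close>

lemma sweedler_S:
  assumes "bilinear_map H H scalars F"
  shows "sweedler (S x) F = sweedler x (\<lambda>u v. F (S v) (S u))"
proof -
  have "bilinear_map H H scalars (\<lambda>u v. F (S v) (S u))"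
    using assms by (simp add: lin_simps)
  from sweedler_T[OF this, of "S x"] show ?thesis by simp
qed

text \<open>This is \<open>S\<close> applied to \<open>(id \<star> T) x\<close>. In a Hopf algebra
  it reduces to the counit.\<close>

definition d :: "'h \<Rightarrow> 'h" where "d x = sweedler x (\<lambda>x' x''. x'' * S x')"

lemma S_sweedler: "S (sweedler x F) = sweedler x (\<lambda>u v. S (F u v))"
  unfolding sweedler_def
  \<comment> \<open>The instance of \<open>S_scale\<close> with both arguments 0 says
    \<open>S 0 = 0\<close>.\<close>
  by (rule tensor_sum_hom) (use S_scale[of 0 0] in \<open>simp_all add: S_add\<close>)

text \<open>Linearity in the element being split is available for scalar forms only, so that of the
  vector-valued \<open>d\<close> is obtained through functionals.\<close>

lemma lin_d:
  assumes "lin sH f" shows "lin sH (\<lambda>x. f (d x))"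
proof -
  have "lin sH (\<lambda>x. sweedler x (\<lambda>x' x''. f (x'' * S x')))"
    by (rule lin_sweedler) (use assms in \<open>simp add: lin_simps\<close>)
  thus ?thesis by (simp add: d_def sweedler_lin[OF assms])
qed

lemma d_add: "d (x + y) = d x + d y" and d_scale: "d (sH c x) = sH c (d x)"
  by (rule vector_eqI[OF vector_space_axioms], use lin_d in \<open>simp add: lin_def\<close>)+

text \<open>Perfectness says that \<open>(id \<star> T) x\<close> commutes with \<open>T y\<close>.
  Applying \<open>S\<close> reverses the products and turns \<open>T y\<close> into
  \<open>y\<close>.\<close>

lemma d_central: "d x * y = y * d x"
proof -
  have d: "d x = S ((id \<star> T) x)"
    by (simp add: d_def convolution_def S_sweedler S_mult)
  have "(id \<star> T) x * T y = T y * (id \<star> T) x"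
    using perfect by (simp add: perfect_def)
  hence "S ((id \<star> T) x * T y) = S (T y * (id \<star> T) x)" by (rule arg_cong)
  thus ?thesis by (simp add: S_mult d)
qed

text \<open>The coperfectness identity with \<open>S\<close> applied to its first tensor
  factor.\<close>

lemma d_flip:
  assumes "bilinear_map H H scalars F"
  shows "sweedler x (\<lambda>u v. F (d u) v) = sweedler x (\<lambda>u v. F (d v) u)"
proof -
  have lF: "lin sH (\<lambda>u. F u v)" "lin sH (\<lambda>v. F u v)" for u v
    using assms by (auto simp: bilinear_map_full_iff)
  have "bilinear_map H H scalars (\<lambda>u v. F (S u) v)"
    using assms by (simp add: lin_simps)
  moreover have "sweedler3 x (\<lambda>x' x'' x'''. pure_tensor H H (x' * T x'') x''')
        = sweedler3 x (\<lambda>x' x'' x'''. pure_tensor H H (x'' * T x''') x')"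
    using coperfect by (simp add: coperfect_def)
  ultimately have "sweedler x (\<lambda>a u. sweedler u (\<lambda>b c. F (S (a * T b)) c)) =
      sweedler x (\<lambda>a u. sweedler u (\<lambda>b c. F (S (b * T c)) a))"
    unfolding sweedler3_tensor_eq_iff by blast
  \<comment> \<open>On this side the first two legs form \<open>d\<close>, so the bracketing has to
    be moved to the left before \<open>d\<close> is recognised.\<close>
  also have "sweedler x (\<lambda>a u. sweedler u (\<lambda>b c. F (S (a * T b)) c)) =
      sweedler x (\<lambda>u c. sweedler u (\<lambda>a b. F (S (a * T b)) c))"
    by (rule sweedler_coassoc[symmetric]) (use lF in \<open>simp_all add: lin_simps\<close>)
  finally show ?thesis by (simp add: d_def sweedler_lin[OF lF(1)] S_mult)
qed

text \<open>\<open>S\<close> sends T(a) b T(c) to c S(b) a, so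
  \<open>T \<star> id \<star> T = T\<close> becomes this identity once the last two legs are grouped
  into \<open>d\<close>.\<close>

lemma d_mult_sweedler: "sweedler x (\<lambda>u v. d v * u) = x"
proof (rule vector_eqI[OF vector_space_axioms])
  fix f assume f: "lin sH f"
  have "(T \<star> id \<star> T) x = T x" using weak_antipode by (simp add: weak_antipode_def)
  hence "S ((T \<star> id \<star> T) x) = x" by simp
  hence "sweedler x (\<lambda>u c. sweedler u (\<lambda>a b. c * (S b * a))) = x"
    by (simp add: convolution_def S_sweedler S_mult sweedler_mult_left)
  hence "f x = f (sweedler x (\<lambda>u c. sweedler u (\<lambda>a b. c * (S b * a))))" by simp
  also have "\<dots> = sweedler x (\<lambda>a m. sweedler m (\<lambda>b c. f (c * (S b * a))))"
    unfolding sweedler_lin[OF f]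
    by (rule sweedler_coassoc) (use f in \<open>simp_all add: lin_simps\<close>)
  finally show "f (sweedler x (\<lambda>u v. d v * u)) = f x"
    by (simp add: sweedler_lin[OF f] d_def sweedler_mult_right[symmetric] mult.assoc)
qed

text \<open>The identity \<open>id \<star> T \<star> id = id\<close> at \<open>S x\<close>: the
  coproduct of \<open>S x\<close> is reversed with \<open>S\<close> on each leg, and on the middle
  leg \<open>T\<close> cancels \<open>S\<close>.\<close>

lemma weak_antipode_S:
  "sweedler x (\<lambda>p q. sweedler q (\<lambda>r s. S s * r * S p)) = S x"
proof (rule vector_eqI[OF vector_space_axioms])
  fix f assume f: "lin sH f"
  have "(id \<star> T \<star> id) (S x) = S x" using weak_antipode by (simp add: weak_antipode_def)
  hence "f (S x) = f (sweedler (S x) (\<lambda>u c. sweedler u (\<lambda>a b. a * T b * c)))"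
    by (simp add: convolution_def sweedler_mult_right)
  also have "\<dots> = sweedler (S x) (\<lambda>u c. sweedler u (\<lambda>a b. f (a * T b * c)))"
    by (simp add: sweedler_lin[OF f])
  also have "\<dots> = sweedler x (\<lambda>p q. sweedler (S q) (\<lambda>a b. f (a * T b * S p)))"
    by (rule sweedler_S) (use f in \<open>simp add: lin_simps\<close>)
  also have "\<dots> = sweedler x (\<lambda>p q. sweedler q (\<lambda>r s. f (S s * r * S p)))"
    by (subst sweedler_S) (use f in \<open>simp_all add: lin_simps\<close>)
  finally show "f (sweedler x (\<lambda>p q. sweedler q (\<lambda>r s. S s * r * S p))) = f (S x)"
    by (simp add: sweedler_lin[OF f])
qed

text \<open>The inner \<open>x\<close> and \<open>S q\<close> form the central element \<open>d\<close>, so they can be moved next to \<open>p\<close>.\<close>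

lemma antipode_cancel:
  assumes g: "lin sH g"
  shows "sweedler u (\<lambda>a x. sweedler a (\<lambda>p q. g (k * (x * (S q * (t * p)))))) = g (k * (t * u))"
proof -
  have "sweedler u (\<lambda>a x. sweedler a (\<lambda>p q. g (k * (x * (S q * (t * p)))))) =
      sweedler u (\<lambda>p m. sweedler m (\<lambda>q x. g (k * (x * (S q * (t * p))))))"
    by (rule sweedler_coassoc) (use g in \<open>simp_all add: lin_simps\<close>)
  also have "\<dots> = sweedler u (\<lambda>p m. g (k * (d m * (t * p))))"
    by (simp add: d_def sweedler_mult_right[symmetric] sweedler_mult_left[symmetric]
        sweedler_lin[OF g] mult.assoc)
  also have "\<dots> = sweedler u (\<lambda>p m. g (k * (t * (d m * p))))"
    by (simp only: mult.assoc[symmetric] d_central[of _ t])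
  also have "\<dots> = g (k * (t * sweedler u (\<lambda>p m. d m * p)))"
    by (simp add: sweedler_mult_left[symmetric] sweedler_lin[OF g])
  finally show ?thesis by (simp add: d_mult_sweedler)
qed

end

section \<open>Crossed bimodules in terms of bilinear forms\<close>

locale fd_biperfect_space = fd_biperfect sH \<Delta> \<epsilon> T + V: vector_space sV
  for sH :: "'k::field \<Rightarrow> 'h::ring_1 \<Rightarrow> 'h" and \<Delta> \<epsilon> T
    and sV :: "'k \<Rightarrow> 'v::ab_group_add \<Rightarrow> 'v"
begin

abbreviation V where "V \<equiv> full_space sV"

abbreviation dsum where "dsum \<delta> \<beta> \<equiv> tensor_sum V H (\<delta> \<beta>)"

lemma lin_dsum:
  assumes "linear_map V (tensor_space V H) \<delta>" "bilinear_map V H scalars G"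
  shows "lin sV (\<lambda>\<beta>. dsum \<delta> \<beta> G)"
proof -
  have "\<delta> \<beta> \<in> vecs (tensor_space V H)" for \<beta> using assms(1) by (simp add: linear_map_def)
  from tensor_apply[OF assms(2) this] have "dsum \<delta> \<beta> G = \<delta> \<beta> G" for \<beta> by simp
  thus ?thesis using assms(1)
    by (simp add: lin_def linear_map_def tensor_space_def)
qed

lemma dsum_add:
  assumes "linear_map V (tensor_space V H) \<delta>" "bilinear_map V H scalars G"
  shows "dsum \<delta> (\<beta> + \<gamma>) G = dsum \<delta> \<beta> G + dsum \<delta> \<gamma> G"
  and "dsum \<delta> (sV c \<beta>) G = c * dsum \<delta> \<beta> G"
  using lin_dsum[OF assms] by (auto simp: lin_def)

lemma dsum_lin: "lin s f \<Longrightarrow> f (dsum \<delta> \<beta> F) = dsum \<delta> \<beta> (\<lambda>u v. f (F u v))"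
  by (rule tensor_sum_hom) (auto simp: lin_zero lin_add)

lemma bilinear_map_V_iff:
  "bilinear_map H V V \<mu> \<longleftrightarrow>
    (\<forall>a b \<beta>. \<mu> (a + b) \<beta> = \<mu> a \<beta> + \<mu> b \<beta>) \<and> (\<forall>c a \<beta>. \<mu> (sH c a) \<beta> = sV c (\<mu> a \<beta>)) \<and>
    (\<forall>a \<beta> \<gamma>. \<mu> a (\<beta> + \<gamma>) = \<mu> a \<beta> + \<mu> a \<gamma>) \<and> (\<forall>c a \<beta>. \<mu> a (sV c \<beta>) = sV c (\<mu> a \<beta>))"
  by (auto simp: bilinear_map_def linear_map_def)

definition coaction_coassoc :: "('v \<Rightarrow> ('v \<Rightarrow> 'h \<Rightarrow> 'k) \<Rightarrow> 'k) \<Rightarrow> bool" where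
  "coaction_coassoc \<delta> \<longleftrightarrow> (\<forall>\<beta> F.
    (\<forall>x y. lin sV (\<lambda>v. F v x y)) \<and> (\<forall>v y. lin sH (\<lambda>x. F v x y)) \<and> (\<forall>v x. lin sH (\<lambda>y. F v x y)) \<longrightarrow>
    dsum \<delta> \<beta> (\<lambda>v h. dsum \<delta> v (\<lambda>v' h'. F v' h' h)) = dsum \<delta> \<beta> (\<lambda>v h. sweedler h (\<lambda>x y. F v x y)))"

text \<open>The comodule axiom lives in V \<otimes> (H \<otimes> H). A trilinear form extends to a
  bilinear one on V and H \<otimes> H by the universal property; conversely such a bilinear form
  restricted to pure tensors is trilinear.\<close>

lemma coaction_coassoc_iff:
  "(\<forall>\<beta>. dsum \<delta> \<beta> (\<lambda>\<beta>\<^sub>V \<beta>\<^sub>H. dsum \<delta> \<beta>\<^sub>V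
          (\<lambda>\<gamma> x. pure_tensor V (tensor_space H H) \<gamma> (pure_tensor H H x \<beta>\<^sub>H)))
      = dsum \<delta> \<beta> (\<lambda>\<beta>\<^sub>V \<beta>\<^sub>H. pure_tensor V (tensor_space H H) \<beta>\<^sub>V (\<Delta> \<beta>\<^sub>H))) \<longleftrightarrow> coaction_coassoc \<delta>"
  (is "(\<forall>\<beta>. ?l \<beta> = ?r \<beta>) \<longleftrightarrow> _")
proof
  assume eq: "\<forall>\<beta>. ?l \<beta> = ?r \<beta>"
  show "coaction_coassoc \<delta>"
    unfolding coaction_coassoc_def
  proof (intro allI impI)
    fix \<beta> and F :: "'v \<Rightarrow> 'h \<Rightarrow> 'h \<Rightarrow> 'k"
    assume F: "(\<forall>x y. lin sV (\<lambda>v. F v x y)) \<and> (\<forall>v y. lin sH (\<lambda>x. F v x y)) \<and> (\<forall>v x. lin sH (\<lambda>y. F v x y))"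
    have bF: "bilinear_map H H scalars (F v)" for v
      using F by (simp add: bilinear_map_full_iff)
    \<comment> \<open>The bilinear form that \<open>F v\<close> induces on the inner tensor product,
      used as the test form for the axiom.\<close>
    define G where "G = (\<lambda>v (w :: ('h \<Rightarrow> 'h \<Rightarrow> 'k) \<Rightarrow> 'k). tensor_sum H H w (F v))"
    have G: "bilinear_map V (tensor_space H H) scalars G"
      unfolding bilinear_map_def
    proof (intro conjI ballI)
      fix u show "linear_map (tensor_space H H) scalars (G u)"
        unfolding G_def by (rule tensor_universal(1)) (simp_all add: is_vspace_scalars bF is_vspace_full_space vector_space_axioms)
    next
      fix w assume "w \<in> vecs (tensor_space H H)"
      have "F (x + x') = (\<lambda>y z. F x y z + F x' y z)" "F (sV c x) = (\<lambda>y z. c * F x y z)" for x x' c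
        using F by (auto simp: lin_def fun_eq_iff)
      thus "linear_map V scalars (\<lambda>u. G u w)" unfolding linear_map_full_iff G_def
        by (simp add: lin_def tensor_sum_add tensor_sum_mult_left)
    qed
    have G_pure: "G v (pure_tensor H H y z) = F v y z" for v y z
      unfolding G_def by (subst tensor_universal(2)[where C = scalars]) (simp_all add: is_vspace_scalars bF is_vspace_full_space vector_space_axioms)
    have G_comult: "G y (\<Delta> z) = sweedler z (F y)" for y z
      by (simp add: G_def sweedler_def)
    have "?l \<beta> G = ?r \<beta> G" using eq by simp
    thus "dsum \<delta> \<beta> (\<lambda>v h. dsum \<delta> v (\<lambda>v' h'. F v' h' h)) = dsum \<delta> \<beta> (\<lambda>v h. sweedler h (\<lambda>x y. F v x y))"
      unfolding tensor_sum_fun_apply pure_tensor_def[of _ "tensor_space H H"]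
      by (simp add: G G_pure G_comult)
  qed
next
  assume co: "coaction_coassoc \<delta>"
  show "\<forall>\<beta>. ?l \<beta> = ?r \<beta>"
  proof (intro allI ext)
    fix \<beta> G
    show "?l \<beta> G = ?r \<beta> G"
    proof (cases "bilinear_map V (tensor_space H H) scalars G")
      case G: True
      have G1: "linear_map (tensor_space H H) scalars (G v)" for v
        using G by (simp add: bilinear_map_def)
      have G2: "w \<in> vecs (tensor_space H H) \<Longrightarrow> lin sV (\<lambda>v. G v w)" for w
        using G by (simp add: bilinear_map_def linear_map_full_iff)
      have G_comult: "G v (\<Delta> h) = sweedler h (\<lambda>x y. G v (pure_tensor H H x y))" for v h
        unfolding sweedler_def by (rule linear_on_tensor[OF G1 comult_mem])
      have add: "G v (t + t') = G v t + G v t'"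
        and scale: "G v (smul (tensor_space H H) c t) = c * G v t"
        if "t \<in> vecs (tensor_space H H)" "t' \<in> vecs (tensor_space H H)" for v t t' c
        using G1[of v] that by (auto simp: linear_map_def)
      have m: "pure_tensor H H x y \<in> vecs (tensor_space H H)" for x y
        by (simp add: pure_tensor_mem)
      have s: "pure_tensor H H (sH c x) y = smul (tensor_space H H) c (pure_tensor H H x y)"
        "pure_tensor H H x (sH c y) = smul (tensor_space H H) c (pure_tensor H H x y)" for c x y
        using pure_tensor_scale_left[of x H y H c] pure_tensor_scale_right[of x H y H c] by simp_all
      have "\<forall>x y. lin sV (\<lambda>v. G v (pure_tensor H H x y))"
        by (simp add: G2 m)
      moreover have "\<forall>v y. lin sH (\<lambda>x. G v (pure_tensor H H x y))"
        unfolding lin_def s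
        by (auto simp: pure_tensor_add_left add[OF m m] scale[OF m m] simp del: plus_fun_apply)
      moreover have "\<forall>v x. lin sH (\<lambda>y. G v (pure_tensor H H x y))"
        unfolding lin_def s
        by (auto simp: pure_tensor_add_right add[OF m m] scale[OF m m] simp del: plus_fun_apply)
      ultimately show ?thesis
        using co unfolding coaction_coassoc_def
        unfolding tensor_sum_fun_apply pure_tensor_def[of _ "tensor_space H H"]
        by (simp add: G G_comult)
    next
      case False
      thus ?thesis
        unfolding tensor_sum_fun_apply pure_tensor_def[of _ "tensor_space H H"] by simp
    qed
  qed
qed

definition crossed_compat :: "('h \<Rightarrow> 'v \<Rightarrow> 'v) \<Rightarrow> ('v \<Rightarrow> ('v \<Rightarrow> 'h \<Rightarrow> 'k) \<Rightarrow> 'k) \<Rightarrow> bool" where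
  "crossed_compat \<mu> \<delta> \<longleftrightarrow> (\<forall>a \<beta> B. bilinear_map V H scalars B \<longrightarrow>
     sweedler a (\<lambda>p q. dsum \<delta> \<beta> (\<lambda>v h. B (\<mu> p v) (q * h))) =
     sweedler a (\<lambda>x y. dsum \<delta> (\<mu> y \<beta>) (\<lambda>v h. B v (h * x))))"

text \<open>The tensor factors are interchanged against \<open>twist_condition\<close>, so that all
  three compatibilities use test forms with the argument from V first.\<close>

definition twist_compat :: "('h \<Rightarrow> 'v \<Rightarrow> 'v) \<Rightarrow> ('v \<Rightarrow> ('v \<Rightarrow> 'h \<Rightarrow> 'k) \<Rightarrow> 'k) \<Rightarrow> bool" where
  "twist_compat \<mu> \<delta> \<longleftrightarrow> (\<forall>a \<beta> B. bilinear_map V H scalars B \<longrightarrow>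
     sweedler a (\<lambda>p u. sweedler u (\<lambda>q r. dsum \<delta> \<beta> (\<lambda>v h. B (\<mu> p v) (S r * q * h)))) =
     dsum \<delta> \<beta> (\<lambda>v h. B (\<mu> a v) h))"

text \<open>The commutation rule between the two factors of the double, dualised: associativity of
  the action at the product of \<epsilon> \<infinity> a and g \<infinity> 1 says exactly how
  \<open>a\<close> passes \<open>g\<close>.\<close>

definition double_compat :: "('h \<Rightarrow> 'v \<Rightarrow> 'v) \<Rightarrow> ('v \<Rightarrow> ('v \<Rightarrow> 'h \<Rightarrow> 'k) \<Rightarrow> 'k) \<Rightarrow> bool" where
  "double_compat \<mu> \<delta> \<longleftrightarrow> (\<forall>a \<beta> B. bilinear_map V H scalars B \<longrightarrow>
     dsum \<delta> \<beta> (\<lambda>v h. B (\<mu> a v) h) =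
     sweedler a (\<lambda>x w. sweedler w (\<lambda>y z. dsum \<delta> (\<mu> y \<beta>) (\<lambda>v h. B v (S z * h * x)))))"

lemma crossed_bimodule_iff:
  "crossed_bimodule sV \<mu> \<delta> \<longleftrightarrow> left_module H (*) 1 V \<mu> \<and>
     linear_map V (tensor_space V H) \<delta> \<and> coaction_coassoc \<delta> \<and>
     (\<forall>\<beta>. dsum \<delta> \<beta> (\<lambda>v h. sV (\<epsilon> h) v) = \<beta>) \<and> crossed_compat \<mu> \<delta>"
proof -
  have "sweedler a (\<lambda>a' a''. dsum \<delta> \<beta> (\<lambda>\<beta>\<^sub>V \<beta>\<^sub>H. pure_tensor V H (\<mu> a' \<beta>\<^sub>V) (a'' * \<beta>\<^sub>H)))
          = sweedler a (\<lambda>a' a''. dsum \<delta> (\<mu> a'' \<beta>) (\<lambda>\<gamma>\<^sub>V \<gamma>\<^sub>H. pure_tensor V H \<gamma>\<^sub>V (\<gamma>\<^sub>H * a')))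
      \<longleftrightarrow> (\<forall>B. bilinear_map V H scalars B \<longrightarrow>
     sweedler a (\<lambda>p q. dsum \<delta> \<beta> (\<lambda>v h. B (\<mu> p v) (q * h))) =
     sweedler a (\<lambda>x y. dsum \<delta> (\<mu> y \<beta>) (\<lambda>v h. B v (h * x))))" for a \<beta>
    unfolding fun_eq_iff sweedler_fun_apply tensor_sum_fun_apply
    by (rule iff_allI, rename_tac K, case_tac "bilinear_map V H scalars K") (simp_all add: pure_tensor_def)
  thus ?thesis
    unfolding crossed_bimodule_def Let_def right_comodule_def crossed_compat_def
      coaction_coassoc_iff[symmetric] by simp
qed

lemma twist_condition_iff: "twist_condition sV \<mu> \<delta> \<longleftrightarrow> twist_compat \<mu> \<delta>"
proof -
  have flip: "bilinear_map H V scalars (\<lambda>h v. B v h) \<longleftrightarrow> bilinear_map V H scalars B" for B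
    by (auto simp: bilinear_map_full_iff)
  have "(sweedler3 a (\<lambda>a' a'' a'''. dsum \<delta> \<beta> (\<lambda>\<beta>\<^sub>V \<beta>\<^sub>H.
             pure_tensor H V (S a''' * a'' * \<beta>\<^sub>H) (\<mu> a' \<beta>\<^sub>V)))
         = dsum \<delta> \<beta> (\<lambda>\<beta>\<^sub>V \<beta>\<^sub>H. pure_tensor H V \<beta>\<^sub>H (\<mu> a \<beta>\<^sub>V))) \<longleftrightarrow>
     (\<forall>B. bilinear_map H V scalars B \<longrightarrow>
     sweedler a (\<lambda>p u. sweedler u (\<lambda>q r. dsum \<delta> \<beta> (\<lambda>v h. B (S r * q * h) (\<mu> p v)))) =
     dsum \<delta> \<beta> (\<lambda>v h. B h (\<mu> a v)))" for a \<beta>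
    unfolding fun_eq_iff sweedler_fun_apply tensor_sum_fun_apply sweedler3_def
    by (rule iff_allI, rename_tac K, case_tac "bilinear_map H V scalars K") (simp_all add: pure_tensor_def)
  note eq1 = this
  \<comment> \<open>Transposing the arguments matches the bilinear forms on H and V with those on V
    and H.\<close>
  have eq2: "(\<forall>B. bilinear_map H V scalars B \<longrightarrow> P (\<lambda>v h. B h v)) \<longleftrightarrow>
      (\<forall>B. bilinear_map V H scalars B \<longrightarrow> P B)" for P :: "('v \<Rightarrow> 'h \<Rightarrow> 'k) \<Rightarrow> bool"
  proof (intro iffI allI impI)
    fix B :: "'v \<Rightarrow> 'h \<Rightarrow> 'k"
    assume "\<forall>B. bilinear_map H V scalars B \<longrightarrow> P (\<lambda>v h. B h v)" "bilinear_map V H scalars B"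
    from spec[OF this(1), of "\<lambda>h v. B v h"] this(2) show "P B" by (simp add: flip)
  next
    fix B :: "'h \<Rightarrow> 'v \<Rightarrow> 'k"
    assume "\<forall>B. bilinear_map V H scalars B \<longrightarrow> P B" "bilinear_map H V scalars B"
    from spec[OF this(1), of "\<lambda>v h. B h v"] this(2) show "P (\<lambda>v h. B h v)"
      by (simp add: flip[symmetric])
  qed
  show ?thesis
    unfolding twist_condition_def Let_def twist_compat_def eq1
    using eq2[of "\<lambda>B. sweedler a (\<lambda>p u. sweedler u (\<lambda>q r. dsum \<delta> \<beta> (\<lambda>v h. B (\<mu> p v) (S r * q * h)))) =
     dsum \<delta> \<beta> (\<lambda>v h. B (\<mu> a v) h)" for a \<beta>] by simp
qed

lemma double_compat_iff:
  assumes \<mu>: "bilinear_map H V V \<mu>" and \<delta>: "linear_map V (tensor_space V H) \<delta>"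
  shows "double_compat \<mu> \<delta> \<longleftrightarrow> crossed_compat \<mu> \<delta> \<and> twist_compat \<mu> \<delta>"
proof -
  note ls = lin_simps tensor_sum_add tensor_sum_mult_left dsum_add[OF \<delta>] \<mu>[unfolded bilinear_map_V_iff]
  \<comment> \<open>With this bracketing \<open>x\<close> and \<open>y\<close> are the legs of one
    element \<open>b\<close>, to which \<open>crossed_compat\<close> applies while \<open>z\<close>
    stays a parameter.\<close>
  have coassoc_right: "sweedler a (\<lambda>x w. sweedler w (\<lambda>y z. dsum \<delta> (\<mu> y \<beta>) (\<lambda>v h. B v (S z * h * x)))) =
      sweedler a (\<lambda>b z. sweedler b (\<lambda>x y. dsum \<delta> (\<mu> y \<beta>) (\<lambda>v h. B v (S z * h * x))))"
    if "bilinear_map V H scalars B" for a \<beta> B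
    by (rule sweedler_coassoc[symmetric]) (use that in \<open>simp_all add: ls\<close>)
  show ?thesis
  proof (intro iffI conjI)
    assume "crossed_compat \<mu> \<delta> \<and> twist_compat \<mu> \<delta>"
    hence c: "crossed_compat \<mu> \<delta>" and t: "twist_compat \<mu> \<delta>" by auto
    show "double_compat \<mu> \<delta>"
      unfolding double_compat_def
    proof (intro allI impI)
      fix a \<beta> and B :: "'v \<Rightarrow> 'h \<Rightarrow> 'k" assume B: "bilinear_map V H scalars B"
      have "sweedler b (\<lambda>x y. dsum \<delta> (\<mu> y \<beta>) (\<lambda>v h. B v (S z * h * x))) =
         sweedler b (\<lambda>x y. dsum \<delta> \<beta> (\<lambda>v h. B (\<mu> x v) (S z * y * h)))" for b z
      proof -
        \<comment> \<open>The factor \<open>S z\<close> is absorbed into the test form. What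
          \<open>crossed_compat\<close> then produces is the left side of
          \<open>twist_compat\<close> up to bracketing.\<close>
        have "bilinear_map V H scalars (\<lambda>v h. B v (S z * h))" using B by (simp add: ls)
        from c[unfolded crossed_compat_def, rule_format, OF this, of b \<beta>]
        show ?thesis by (simp add: mult.assoc)
      qed
      hence "sweedler a (\<lambda>b z. sweedler b (\<lambda>x y. dsum \<delta> (\<mu> y \<beta>) (\<lambda>v h. B v (S z * h * x)))) =
        sweedler a (\<lambda>b z. sweedler b (\<lambda>x y. dsum \<delta> \<beta> (\<lambda>v h. B (\<mu> x v) (S z * y * h))))"
        by simp
      also have "\<dots> = sweedler a (\<lambda>x w. sweedler w (\<lambda>y z. dsum \<delta> \<beta> (\<lambda>v h. B (\<mu> x v) (S z * y * h))))"
        by (rule sweedler_coassoc) (use B in \<open>simp_all add: ls\<close>)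
      also have "\<dots> = dsum \<delta> \<beta> (\<lambda>v h. B (\<mu> a v) h)"
        using t B unfolding twist_compat_def by simp
      finally show "dsum \<delta> \<beta> (\<lambda>v h. B (\<mu> a v) h) =
         sweedler a (\<lambda>x w. sweedler w (\<lambda>y z. dsum \<delta> (\<mu> y \<beta>) (\<lambda>v h. B v (S z * h * x))))"
        by (simp add: coassoc_right[OF B])
    qed
  next
    assume D: "double_compat \<mu> \<delta>"
    show "crossed_compat \<mu> \<delta>"
      unfolding crossed_compat_def
    proof (intro allI impI)
      fix a \<beta> and B :: "'v \<Rightarrow> 'h \<Rightarrow> 'k" assume B: "bilinear_map V H scalars B"
      have B2: "lin sH (\<lambda>h. B v h)" for v using B by (simp add: bilinear_map_full_iff)
      \<comment> \<open>\<open>double_compat\<close> for the leg \<open>p\<close>, with the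
        remaining leg \<open>q\<close> of \<open>a\<close> put into the test form as a left
        factor.\<close>
      have "dsum \<delta> \<beta> (\<lambda>v h. B (\<mu> p v) (q * h)) = sweedler p (\<lambda>x w. sweedler w (\<lambda>y z.
          dsum \<delta> (\<mu> y \<beta>) (\<lambda>v h. B v (q * (S z * h * x)))))" for p q
      proof -
        have "bilinear_map V H scalars (\<lambda>v h. B v (q * h))" using B by (simp add: ls)
        from D[unfolded double_compat_def, rule_format, OF this, of \<beta> p] show ?thesis by simp
      qed
      hence "sweedler a (\<lambda>p q. dsum \<delta> \<beta> (\<lambda>v h. B (\<mu> p v) (q * h))) =
        sweedler a (\<lambda>p q. sweedler p (\<lambda>x w. sweedler w (\<lambda>y z.
          dsum \<delta> (\<mu> y \<beta>) (\<lambda>v h. B v (q * (S z * h * x))))))" by simp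
      also have "\<dots> = sweedler a (\<lambda>x m. sweedler m (\<lambda>w q. sweedler w (\<lambda>y z.
          dsum \<delta> (\<mu> y \<beta>) (\<lambda>v h. B v (q * (S z * h * x))))))"
        by (rule sweedler_coassoc) (use B in \<open>simp_all add: ls\<close>)
      also have "\<dots> = sweedler a (\<lambda>x m. sweedler m (\<lambda>y n. sweedler n (\<lambda>z q.
          dsum \<delta> (\<mu> y \<beta>) (\<lambda>v h. B v (q * (S z * h * x))))))"
        by (subst sweedler_coassoc) (use B in \<open>simp_all add: ls\<close>)
      also have "\<dots> = sweedler a (\<lambda>x m. sweedler m (\<lambda>y n. dsum \<delta> (\<mu> y \<beta>) (\<lambda>v h. B v (h * (d n * x)))))"
      proof -
        \<comment> \<open>\<open>z\<close> and \<open>q\<close> are the legs of \<open>n\<close>, so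
          \<open>q * S z\<close> sums to \<open>d n\<close>, which is central and can pass
          \<open>h\<close>.\<close>
        have "sweedler n (\<lambda>z q. B v (q * (S z * h * x))) = B v (h * (d n * x))" for n v h x
        proof -
          have "sweedler n (\<lambda>z q. B v (q * (S z * h * x))) = B v (d n * h * x)"
            by (simp add: d_def sweedler_lin[OF B2] sweedler_mult_right[symmetric] mult.assoc)
          thus ?thesis by (simp add: d_central[of n h] mult.assoc)
        qed
        thus ?thesis by (simp add: sweedler_tensor_swap)
      qed
      \<comment> \<open>The flip moves the argument of \<open>d\<close> in front of
        \<open>y\<close>. After regrouping, \<open>x\<close> and \<open>n\<close> are the legs of a
        single \<open>b\<close>, and \<open>d n * x\<close> contracts to \<open>b\<close>.\<close>
      also have "\<dots> = sweedler a (\<lambda>x m. sweedler m (\<lambda>n y. dsum \<delta> (\<mu> y \<beta>) (\<lambda>v h. B v (h * (d n * x)))))"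
      proof -
        have "sweedler m (\<lambda>n y. dsum \<delta> (\<mu> y \<beta>) (\<lambda>v h. B v (h * (d n * x)))) =
            sweedler m (\<lambda>y n. dsum \<delta> (\<mu> y \<beta>) (\<lambda>v h. B v (h * (d n * x))))" for m x
          by (rule d_flip[where F = "\<lambda>e y. dsum \<delta> (\<mu> y \<beta>) (\<lambda>v h. B v (h * (e * x)))"])
            (use B in \<open>simp add: ls\<close>)
        thus ?thesis by simp
      qed
      also have "\<dots> = sweedler a (\<lambda>b y. sweedler b (\<lambda>x n. dsum \<delta> (\<mu> y \<beta>) (\<lambda>v h. B v (h * (d n * x)))))"
        by (rule sweedler_coassoc[symmetric]) (use B in \<open>simp_all add: ls d_add d_scale\<close>)
      also have "\<dots> = sweedler a (\<lambda>b y. dsum \<delta> (\<mu> y \<beta>) (\<lambda>v h. B v (h * b)))"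
      proof -
        have "sweedler b (\<lambda>x n. B v (h * (d n * x))) = B v (h * b)" for b v h
          using sweedler_lin[OF B2, of v b "\<lambda>x n. h * (d n * x)"]
          by (simp add: sweedler_mult_left d_mult_sweedler)
        thus ?thesis by (simp add: sweedler_tensor_swap)
      qed
      finally show "sweedler a (\<lambda>p q. dsum \<delta> \<beta> (\<lambda>v h. B (\<mu> p v) (q * h))) =
         sweedler a (\<lambda>x y. dsum \<delta> (\<mu> y \<beta>) (\<lambda>v h. B v (h * x)))" .
    qed
    show "twist_compat \<mu> \<delta>"
      unfolding twist_compat_def
    proof (intro allI impI)
      fix a \<beta> and B :: "'v \<Rightarrow> 'h \<Rightarrow> 'k" assume B: "bilinear_map V H scalars B"
      have B2: "lin sH (\<lambda>h. B v h)" for v using B by (simp add: bilinear_map_full_iff)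
      \<comment> \<open>The same device with extra factor \<open>S t * s\<close>, the one that
        occurs in the twist condition.\<close>
      have "dsum \<delta> \<beta> (\<lambda>v h. B (\<mu> p v) (S t * s * h)) = sweedler p (\<lambda>x w. sweedler w (\<lambda>y z.
          dsum \<delta> (\<mu> y \<beta>) (\<lambda>v h. B v (S t * s * (S z * h * x)))))" for p s t
      proof -
        have "bilinear_map V H scalars (\<lambda>v h. B v (S t * s * h))" using B by (simp add: ls)
        from D[unfolded double_compat_def, rule_format, OF this, of \<beta> p] show ?thesis by simp
      qed
      \<comment> \<open>\<open>p\<close> and \<open>q\<close> are split independently, so the
        splitting of \<open>p\<close> may go outside, where coassociativity can regroup it with that
        of \<open>a\<close>.\<close>
      hence "sweedler q (\<lambda>s t. dsum \<delta> \<beta> (\<lambda>v h. B (\<mu> p v) (S t * s * h))) =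
          sweedler p (\<lambda>x w. sweedler q (\<lambda>s t. sweedler w (\<lambda>y z.
            dsum \<delta> (\<mu> y \<beta>) (\<lambda>v h. B v (S t * s * (S z * h * x))))))" for p q
        by (simp only:) (rule sweedler_swap)
      hence "sweedler a (\<lambda>p q. sweedler q (\<lambda>s t. dsum \<delta> \<beta> (\<lambda>v h. B (\<mu> p v) (S t * s * h)))) =
        sweedler a (\<lambda>p q. sweedler p (\<lambda>x w. sweedler q (\<lambda>s t. sweedler w (\<lambda>y z.
          dsum \<delta> (\<mu> y \<beta>) (\<lambda>v h. B v (S t * s * (S z * h * x)))))))"
        by simp
      also have "\<dots> = sweedler a (\<lambda>x m. sweedler m (\<lambda>w q. sweedler q (\<lambda>s t. sweedler w (\<lambda>y z.
          dsum \<delta> (\<mu> y \<beta>) (\<lambda>v h. B v (S t * s * (S z * h * x)))))))"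
        by (rule sweedler_coassoc) (use B in \<open>simp_all add: ls\<close>)
      also have "\<dots> = sweedler a (\<lambda>x m. sweedler m (\<lambda>w q. sweedler w (\<lambda>y z. sweedler q (\<lambda>s t.
          dsum \<delta> (\<mu> y \<beta>) (\<lambda>v h. B v (S t * s * (S z * h * x)))))))"
        by (rule sweedler_cong, rule sweedler_cong, rule sweedler_swap)
      also have "\<dots> = sweedler a (\<lambda>x m. sweedler m (\<lambda>y n. sweedler n (\<lambda>z q. sweedler q (\<lambda>s t.
          dsum \<delta> (\<mu> y \<beta>) (\<lambda>v h. B v (S t * s * (S z * h * x)))))))"
        by (subst sweedler_coassoc) (use B in \<open>simp_all add: ls\<close>)
      also have "\<dots> = sweedler a (\<lambda>x m. sweedler m (\<lambda>y n. dsum \<delta> (\<mu> y \<beta>) (\<lambda>v h. B v (S n * h * x))))"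
      proof -
        \<comment> \<open>The three legs of \<open>n\<close> collapse to \<open>S n\<close> by
          \<open>weak_antipode_S\<close>. What is left is the right side of
          \<open>double_compat\<close> at \<open>a\<close> itself.\<close>
        have "sweedler n (\<lambda>z q. sweedler q (\<lambda>s t. B v (S t * s * (S z * h * x)))) = B v (S n * h * x)" for n v h x
        proof -
          have "B v (S n * h * x) =
            B v (sweedler n (\<lambda>z q. sweedler q (\<lambda>s t. S t * s * S z)) * (h * x))"
            by (simp only: weak_antipode_S) (simp only: mult.assoc)
          thus ?thesis by (simp add: sweedler_lin[OF B2] sweedler_mult_right[symmetric] mult.assoc)
        qed
        thus ?thesis by (simp add: sweedler_tensor_swap)
      qed
      also have "\<dots> = dsum \<delta> \<beta> (\<lambda>v h. B (\<mu> a v) h)"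
        using D B unfolding double_compat_def by simp
      finally show "sweedler a (\<lambda>p q. sweedler q (\<lambda>s t. dsum \<delta> \<beta> (\<lambda>v h. B (\<mu> p v) (S t * s * h)))) =
         dsum \<delta> \<beta> (\<lambda>v h. B (\<mu> a v) h)" .
    qed
  qed
qed

end

section \<open>The product of the quantum double\<close>

context fd_biperfect
begin

section \<open>Expansion in a dual basis\<close>

lemma dual_basis_exists:
  "\<exists>Bs co. finite Bs \<and> (\<forall>b\<in>Bs. lin sH (co b)) \<and> (\<forall>x. x = (\<Sum>b\<in>Bs. sH (co b x) b))"
proof -
  obtain B where B: "finite B" "span B = UNIV" using fin by auto
  obtain Bs where Bs: "Bs \<subseteq> B" "independent Bs" "B \<subseteq> span Bs"
    using maximal_independent_subset[of B] by metis
  have "span B \<subseteq> span Bs" using Bs(3) by (simp add: span_minimal)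
  with B have sp: "x \<in> span Bs" for x by auto
  have f: "finite Bs" using Bs(1) B(1) by (rule finite_subset)
  have "lin sH (\<lambda>x. representation Bs x b)" for b
    by (simp add: lin_def representation_add[OF Bs(2) sp sp] representation_scale[OF Bs(2) sp])
  moreover have "x = (\<Sum>b\<in>Bs. sH (representation Bs x b) b)" for x
    using sum_representation_eq[OF Bs(2) sp f order_refl, of x] by simp
  ultimately show ?thesis using f by (intro exI[of _ Bs] exI[of _ "\<lambda>b x. representation Bs x b"]) blast
qed

text \<open>\<open>basis\<close> and \<open>coord\<close> enter later arguments only through
  finiteness, linearity and the expansion of a vector, that is, as the canonical element of the dual
  tensor H.\<close>

definition basis :: "'h set" where
  "basis = (SOME Bs. \<exists>co. finite Bs \<and> (\<forall>b\<in>Bs. lin sH (co b)) \<and> (\<forall>x. x = (\<Sum>b\<in>Bs. sH (co b x) b)))"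

definition coord :: "'h \<Rightarrow> 'h \<Rightarrow> 'k" where
  "coord = (SOME co. finite basis \<and> (\<forall>b\<in>basis. lin sH (co b)) \<and> (\<forall>x. x = (\<Sum>b\<in>basis. sH (co b x) b)))"

lemma finite_basis: "finite basis"
  and lin_coord: "b \<in> basis \<Longrightarrow> lin sH (coord b)"
  and coord_expand: "(\<Sum>b\<in>basis. sH (coord b x) b) = x"
proof -
  have "\<exists>co. finite basis \<and> (\<forall>b\<in>basis. lin sH (co b)) \<and> (\<forall>x. x = (\<Sum>b\<in>basis. sH (co b x) b))"
    unfolding basis_def using someI_ex[OF dual_basis_exists] .
  from someI_ex[OF this, folded coord_def]
  show "finite basis" "b \<in> basis \<Longrightarrow> lin sH (coord b)" "(\<Sum>b\<in>basis. sH (coord b x) b) = x"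
    by (blast, blast, metis)
qed

lemma lin_expand: "lin sH f \<Longrightarrow> f x = (\<Sum>b\<in>basis. coord b x * f b)"
  using lin_sum[of sH f "\<lambda>b. sH (coord b x) b" basis] by (simp add: coord_expand lin_scale)

lemma coord_mem: "b \<in> basis \<Longrightarrow> coord b \<in> vecs H_dual"
  by (simp add: vecs_dual_space lin_coord)

text \<open>Any functional \<open>f\<close> is the sum of \<open>f b\<close> times
  \<open>coord b\<close>. As \<open>F\<close> is linear on the carrier only, its passage through the
  sum is an induction that keeps membership.\<close>

lemma linear_map_dual_expand:
  assumes F: "linear_map H_dual scalars F" and f: "f \<in> vecs H_dual"
  shows "F f = (\<Sum>b\<in>basis. f b * F (coord b))"
proof -
  have F_add: "F (g + h) = F g + F h" and F_scale: "F (smul H_dual c g) = c * F g"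
    if "g \<in> vecs H_dual" "h \<in> vecs H_dual" for g h c
    using F that by (auto simp: linear_map_def)
  have mem: "(\<Sum>b\<in>A. smul H_dual (c b) (coord b)) \<in> vecs H_dual \<and>
      F (\<Sum>b\<in>A. smul H_dual (c b) (coord b)) = (\<Sum>b\<in>A. c b * F (coord b))"
    if "finite A" "A \<subseteq> basis" for c A
    using that
  proof (induction A rule: finite_induct)
    case empty
    have "(0 :: 'h \<Rightarrow> 'k) \<in> vecs H_dual" by (simp add: vecs_dual_space lin_def)
    with F_scale[OF this this, of 0] show ?case
      by (simp add: smul_dual_space zero_fun_def)
  next
    case (insert b A)
    have 1: "smul H_dual (c b) (coord b) \<in> vecs H_dual"
      using insert.prems lin_coord[of b] by (simp add: vecs_dual_space smul_dual_space lin_def algebra_simps)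
    let ?s = "\<Sum>b\<in>A. smul H_dual (c b) (coord b)"
    have 2: "?s \<in> vecs H_dual" "F ?s = (\<Sum>b\<in>A. c b * F (coord b))" using insert by auto
    have "smul H_dual (c b) (coord b) + ?s \<in> vecs H_dual"
      using 1 2(1) by (simp add: vecs_dual_space lin_def algebra_simps)
    moreover have "F (smul H_dual (c b) (coord b)) = c b * F (coord b)"
      using F_scale coord_mem insert.prems by auto
    ultimately show ?case
      by (simp only: sum.insert[OF insert.hyps] F_add[OF 1 2(1)] 2(2) simp_thms)
  qed
  have "f = (\<Sum>b\<in>basis. smul H_dual (f b) (coord b))"
  proof
    fix x
    have "f x = (\<Sum>b\<in>basis. coord b x * f b)"
      by (rule lin_expand) (use f in \<open>simp add: vecs_dual_space\<close>)
    thus "f x = (\<Sum>b\<in>basis. smul H_dual (f b) (coord b)) x"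
      by (simp add: sum_fun_apply smul_dual_space mult.commute)
  qed
  thus ?thesis using mem[OF finite_basis order_refl, of f] by simp
qed

lemma bilinear_map_dual_expand:
  assumes F: "bilinear_map H_dual H_dual scalars F" and fg: "f \<in> vecs H_dual" "g \<in> vecs H_dual"
  shows "F f g = (\<Sum>b\<in>basis. \<Sum>c\<in>basis. f b * g c * F (coord b) (coord c))"
proof -
  have "F f g = (\<Sum>b\<in>basis. f b * F (coord b) g)"
    using F fg by (intro linear_map_dual_expand) (auto simp: bilinear_map_def)
  also have "\<dots> = (\<Sum>b\<in>basis. f b * (\<Sum>c\<in>basis. g c * F (coord b) (coord c)))"
    using F fg by (intro sum.cong refl arg_cong2[where f = "(*)"] linear_map_dual_expand)
      (auto simp: bilinear_map_def coord_mem)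
  finally show ?thesis by (simp add: sum_distrib_left mult.assoc)
qed

section \<open>The coproduct of the dual\<close>

lemma bilinear_map_eval:
  "bilinear_map H_dual H_dual scalars (\<lambda>f g. f a * g b)"
  by (auto simp: bilinear_map_def linear_map_def smul_dual_space algebra_simps)

text \<open>By the dual basis every bilinear form on the dual is a combination of products of two
  point evaluations, so those evaluations determine a tensor.\<close>

lemma dual_comult_unique:
  assumes t: "t \<in> vecs (tensor_space H_dual H_dual)" "t' \<in> vecs (tensor_space H_dual H_dual)"
    and eq: "\<And>a b. tensor_sum H_dual H_dual t (\<lambda>f' f''. f' a * f'' b) =
                    tensor_sum H_dual H_dual t' (\<lambda>f' f''. f' a * f'' b)"
  shows "t = t'"
proof (rule tensor_eqI[OF t])
  fix F assume F: "bilinear_map H_dual H_dual scalars F"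
  have "s F = (\<Sum>b\<in>basis. \<Sum>c\<in>basis. tensor_sum H_dual H_dual s (\<lambda>f' f''. f' b * f'' c) * F (coord b) (coord c))"
    if "s \<in> vecs (tensor_space H_dual H_dual)" for s
  proof -
    have "s F = tensor_sum H_dual H_dual s F" by (rule tensor_apply[OF F that])
    also have "\<dots> = tensor_sum H_dual H_dual s (\<lambda>f g. \<Sum>b\<in>basis. \<Sum>c\<in>basis. f b * g c * F (coord b) (coord c))"
      by (rule tensor_sum_cong[OF that]) (rule bilinear_map_dual_expand[OF F])
    finally show ?thesis by (simp add: tensor_sum_sum tensor_sum_mult_right)
  qed
  from this[OF t(1)] this[OF t(2)] show "t F = t' F" by (simp add: eq)
qed

lemma dual_comult_exists:
  assumes g: "g \<in> vecs H_dual"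
  shows "\<exists>t. t \<in> vecs (tensor_space H_dual H_dual) \<and>
     (\<forall>a b. tensor_sum H_dual H_dual t (\<lambda>f' f''. f' a * f'' b) = g (b * a))"
proof (intro exI conjI allI)
  \<comment> \<open>The structure constants of multiplication in the dual basis; the order
    \<open>j * i\<close> encodes the opposite coproduct.\<close>
  let ?t = "\<Sum>i\<in>basis. \<Sum>j\<in>basis. pure_tensor H_dual H_dual (smul H_dual (g (j * i)) (coord i)) (coord j)"
  have sc: "smul H_dual c (coord i) \<in> vecs H_dual" if "i \<in> basis" for c i
    using lin_coord[OF that] by (simp add: vecs_dual_space smul_dual_space lin_def algebra_simps)
  show t: "?t \<in> vecs (tensor_space H_dual H_dual)"
    by (intro tensor_space_sum pure_tensor_mem coord_mem sc)
  fix a b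
  have "tensor_sum H_dual H_dual ?t (\<lambda>f' f''. f' a * f'' b) = ?t (\<lambda>f' f''. f' a * f'' b)"
    by (rule tensor_apply[OF bilinear_map_eval t, symmetric])
  also have "\<dots> = (\<Sum>i\<in>basis. \<Sum>j\<in>basis. coord i a * (coord j b * g (j * i)))"
    by (simp add: sum_fun_apply pure_tensor_def bilinear_map_eval smul_dual_space algebra_simps)
  also have "\<dots> = (\<Sum>i\<in>basis. coord i a * g (b * i))"
  proof (rule sum.cong[OF refl])
    fix i assume "i \<in> basis"
    have "lin sH (\<lambda>x. g (x * i))" using g by (simp add: vecs_dual_space lin_simps)
    from lin_expand[OF this, of b]
    show "(\<Sum>j\<in>basis. coord i a * (coord j b * g (j * i))) = coord i a * g (b * i)"
      by (simp add: sum_distrib_left)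
  qed
  also have "\<dots> = g (b * a)"
  proof -
    have "lin sH (\<lambda>x. g (b * x))" using g by (simp add: vecs_dual_space lin_simps)
    from lin_expand[OF this, of a] show ?thesis by simp
  qed
  finally show "tensor_sum H_dual H_dual ?t (\<lambda>f' f''. f' a * f'' b) = g (b * a)" .
qed

lemma dual_comult:
  assumes g: "g \<in> vecs H_dual"
  shows dual_comult_mem: "dual_comult g \<in> vecs (tensor_space H_dual H_dual)"
    and dual_sweedler_eval: "dual_sweedler g (\<lambda>f' f''. f' a * f'' b) = g (b * a)"
proof -
  let ?P = "\<lambda>t. t \<in> vecs (tensor_space H_dual H_dual) \<and>
     (\<forall>a b. tensor_sum H_dual H_dual t (\<lambda>f' f''. f' a * f'' b) = g (b * a))"
  have "\<exists>!t. ?P t"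
    using dual_comult_exists[OF g] by (rule ex_ex1I) (rule dual_comult_unique, auto)
  hence "?P (dual_comult g)" unfolding dual_comult_def by (rule theI')
  thus "dual_comult g \<in> vecs (tensor_space H_dual H_dual)"
    "dual_sweedler g (\<lambda>f' f''. f' a * f'' b) = g (b * a)"
    by (auto simp: dual_sweedler_def)
qed

lemma dual_sweedler_cong:
  "\<lbrakk>g \<in> vecs H_dual; \<And>u v. u \<in> vecs H_dual \<Longrightarrow> v \<in> vecs H_dual \<Longrightarrow> F u v = G u v\<rbrakk> \<Longrightarrow>
    dual_sweedler g F = dual_sweedler g G"
  unfolding dual_sweedler_def by (rule tensor_sum_cong[OF dual_comult_mem])

lemmas dual_sweedler_mult_left = tensor_sum_mult_left[where A = "H_dual" and B = "H_dual"
    and t = "dual_comult g" for g, folded dual_sweedler_def]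
lemmas dual_sweedler_sum = tensor_sum_sum[where A = "H_dual" and B = "H_dual"
    and t = "dual_comult g" for g, folded dual_sweedler_def]
lemmas dual_sweedler_fun_apply = tensor_sum_fun_apply[where A = "H_dual" and B = "H_dual"
    and t = "dual_comult g" for g, folded dual_sweedler_def]
lemmas dual_sweedler_swap = tensor_sum_swap[where A = "H_dual" and B = "H_dual"
    and t = "dual_comult g" and C = "H" and D = "H" and t' = "\<Delta> y" for g y,
    folded sweedler_def dual_sweedler_def]

section \<open>The mutual actions and the simplified product\<close>

text \<open>Successive legs of a functional in the opposite coproduct evaluate in reversed order:
  values at \<open>p\<close>, \<open>h\<close> and \<open>S q\<close> combine to the value at
  \<open>S q * h * p\<close>.\<close>

lemma act_on_dual_apply:
  assumes g: "g \<in> vecs H_dual"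
  shows "(a \<rhd> g) h = sweedler a (\<lambda>p q. g (S q * h * p))"
proof -
  have "(a \<rhd> g) h = dual_sweedler g (\<lambda>f' f. dual_sweedler f (\<lambda>f'' f'''.
      sweedler a (\<lambda>p q. f' p * f''' (S q)) * f'' h))"
    by (simp add: act_on_dual_def dual_sweedler3_def dual_sweedler_fun_apply smul_dual_space dual_mult_def)
  also have "\<dots> = sweedler a (\<lambda>p q. dual_sweedler g (\<lambda>f' f. f' p * dual_sweedler f (\<lambda>f'' f'''. f'' h * f''' (S q))))"
    unfolding sweedler_mult_right[symmetric] dual_sweedler_swap dual_sweedler_mult_left[symmetric]
    by (simp add: ac_simps)
  also have "\<dots> = sweedler a (\<lambda>p q. dual_sweedler g (\<lambda>f' f. f' p * f (S q * h)))"
    by (intro sweedler_cong dual_sweedler_cong[OF g]) (simp add: dual_sweedler_eval)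
  finally show ?thesis by (simp add: dual_sweedler_eval[OF g])
qed

lemma act_on_dual_mem: "g \<in> vecs H_dual \<Longrightarrow> a \<rhd> g \<in> vecs H_dual"
  unfolding vecs_dual_space[of _ sH] lin_def[of sH "a \<rhd> g"]
  by (simp add: act_on_dual_apply vecs_dual_space) (simp add: lin_simps)

lemma dual_mult_mem:
  assumes "f \<in> vecs H_dual" "g \<in> vecs H_dual"
  shows "dual_mult f g \<in> vecs H_dual"
  using assms unfolding vecs_dual_space dual_mult_def
  by (intro lin_sweedler) (simp add: lin_simps)

lemma acted_by_dual_lin:
  "lin sH f \<Longrightarrow> f (a \<lhd> g) = sweedler a (\<lambda>x w. sweedler w (\<lambda>y z. g (S z * x) * f y))"
  by (simp add: acted_by_dual_def sweedler3_def sweedler_lin lin_scale)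

lemma bilinear_map_dual_H_iff:
  "bilinear_map H_dual H scalars F \<longleftrightarrow>
     (\<forall>f\<in>vecs H_dual. lin sH (F f)) \<and> (\<forall>a. linear_map H_dual scalars (\<lambda>f. F f a))"
  by (simp add: bilinear_map_def linear_map_full_iff)

definition twisted :: "('h \<Rightarrow> 'k) \<Rightarrow> 'h \<Rightarrow> 'h \<Rightarrow> 'h \<Rightarrow> 'k" where
  "twisted g x z = (\<lambda>h. g (S z * h * x))"

lemma twisted_mem: "g \<in> vecs H_dual \<Longrightarrow> twisted g x z \<in> vecs H_dual"
  by (simp add: vecs_dual_space twisted_def lin_simps)

text \<open>The product formula, tested on \<open>F\<close>. Expanding the first argument of
  \<open>F\<close> in the dual basis replaces a functional by its values at basis vectors, so both
  mutual actions unfold into scalar Sweedler sums.\<close>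

lemma double_mult_term:
  assumes F: "bilinear_map H_dual H scalars F" and fg: "f \<in> vecs H_dual" "g \<in> vecs H_dual"
  shows "sweedler a (\<lambda>a' a''. dual_sweedler g (\<lambda>g' g''. F (dual_mult f (a' \<rhd> g')) ((a'' \<lhd> g'') * b))) =
    sweedler a (\<lambda>x w. sweedler w (\<lambda>y z. F (dual_mult f (twisted g x z)) (y * b)))"
proof -
  have F1: "lin sH (F u)" if "u \<in> vecs H_dual" for u
    using F that by (simp add: bilinear_map_dual_H_iff)
  have Fe: "F u x = (\<Sum>i\<in>basis. u i * F (coord i) x)" if "u \<in> vecs H_dual" for u x
    using F that by (intro linear_map_dual_expand) (auto simp: bilinear_map_dual_H_iff)
  have lF: "lin sH (\<lambda>y. F (coord i) (y * b))" if "i \<in> basis" for i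
    using F1[OF coord_mem[OF that]] by (simp add: lin_simps)
  have lg: "lin sH g" "lin sH f" using fg by (simp_all add: vecs_dual_space)
  \<comment> \<open>After regrouping, \<open>a'\<close> and \<open>x\<close> are the legs of one
    element \<open>u\<close>, and \<open>antipode_cancel\<close> with left factor \<open>S z\<close>
    contracts the whole inner product.\<close>
  have key: "sweedler a (\<lambda>a' a''. sweedler a'' (\<lambda>x w. sweedler w (\<lambda>y z.
        sweedler a' (\<lambda>p q. g (S z * (x * (S q * (t * p))))) * k y))) =
      sweedler a (\<lambda>x w. sweedler w (\<lambda>y z. g (S z * (t * x)) * k y))" if k: "lin sH k" for t k
  proof -
    have "sweedler a (\<lambda>a' a''. sweedler a'' (\<lambda>x w. sweedler w (\<lambda>y z.
        sweedler a' (\<lambda>p q. g (S z * (x * (S q * (t * p))))) * k y))) =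
      sweedler a (\<lambda>u w. sweedler u (\<lambda>a' x. sweedler w (\<lambda>y z.
        sweedler a' (\<lambda>p q. g (S z * (x * (S q * (t * p))))) * k y)))"
      by (rule sweedler_coassoc[symmetric]) (use lg k in \<open>simp_all add: lin_simps mult.assoc mult.left_commute\<close>)
    also have "\<dots> = sweedler a (\<lambda>u w. sweedler w (\<lambda>y z. sweedler u (\<lambda>a' x.
        sweedler a' (\<lambda>p q. g (S z * (x * (S q * (t * p)))))) * k y))"
      unfolding sweedler_mult_right[symmetric]
      by (rule sweedler_cong, rule sweedler_swap)
    finally show ?thesis by (simp add: antipode_cancel[OF lg(1)])
  qed
  have "sweedler a (\<lambda>a' a''. dual_sweedler g (\<lambda>g' g''. F (dual_mult f (a' \<rhd> g')) ((a'' \<lhd> g'') * b))) =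
     sweedler a (\<lambda>a' a''. dual_sweedler g (\<lambda>g' g''. \<Sum>i\<in>basis. sweedler i (\<lambda>s t. sweedler a'' (\<lambda>x w. sweedler w (\<lambda>y z.
        sweedler a' (\<lambda>p q. f s * F (coord i) (y * b) * (g' (S q * t * p) * g'' (S z * x))))))))"
  proof (intro sweedler_cong dual_sweedler_cong[OF fg(2)])
    fix a' a'' g' g'' assume g': "g' \<in> vecs H_dual" "g'' \<in> vecs H_dual"
    have "F (dual_mult f (a' \<rhd> g')) ((a'' \<lhd> g'') * b) =
       (\<Sum>i\<in>basis. dual_mult f (a' \<rhd> g') i * F (coord i) ((a'' \<lhd> g'') * b))"
      by (rule Fe) (intro dual_mult_mem fg act_on_dual_mem g')
    also have "\<dots> = (\<Sum>i\<in>basis. sweedler i (\<lambda>s t. f s * sweedler a' (\<lambda>p q. g' (S q * t * p))) *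
        sweedler a'' (\<lambda>x w. sweedler w (\<lambda>y z. g'' (S z * x) * F (coord i) (y * b))))"
      by (intro sum.cong refl arg_cong2[where f = "(*)"] acted_by_dual_lin lF)
        (simp_all add: dual_mult_def act_on_dual_apply[OF g'(1)])
    also have "\<dots> = (\<Sum>i\<in>basis. sweedler i (\<lambda>s t. sweedler a'' (\<lambda>x w. sweedler w (\<lambda>y z.
        sweedler a' (\<lambda>p q. f s * F (coord i) (y * b) * (g' (S q * t * p) * g'' (S z * x)))))))"
    proof (rule sum.cong[OF refl])
      fix i
      show "sweedler i (\<lambda>s t. f s * sweedler a' (\<lambda>p q. g' (S q * t * p))) *
        sweedler a'' (\<lambda>x w. sweedler w (\<lambda>y z. g'' (S z * x) * F (coord i) (y * b))) =
        sweedler i (\<lambda>s t. sweedler a'' (\<lambda>x w. sweedler w (\<lambda>y z.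
        sweedler a' (\<lambda>p q. f s * F (coord i) (y * b) * (g' (S q * t * p) * g'' (S z * x))))))"
        unfolding sweedler_mult_right[symmetric]
        unfolding sweedler_mult_left[symmetric]
        by (rule sweedler_cong)+ (simp add: sweedler_mult_left sweedler_mult_right ac_simps)
    qed
    finally show "F (dual_mult f (a' \<rhd> g')) ((a'' \<lhd> g'') * b) = (\<Sum>i\<in>basis. sweedler i (\<lambda>s t. sweedler a'' (\<lambda>x w. sweedler w (\<lambda>y z.
        sweedler a' (\<lambda>p q. f s * F (coord i) (y * b) * (g' (S q * t * p) * g'' (S z * x)))))))" .
  qed
  \<comment> \<open>\<open>g'\<close> and \<open>g''\<close> now occur only in point evaluations, so
    the dual coproduct collapses. The opposite order puts the argument of \<open>g''\<close> in
    front.\<close>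
  also have "\<dots> = sweedler a (\<lambda>a' a''. \<Sum>i\<in>basis. sweedler i (\<lambda>s t. sweedler a'' (\<lambda>x w. sweedler w (\<lambda>y z.
        sweedler a' (\<lambda>p q. f s * F (coord i) (y * b) * g (S z * (x * (S q * (t * p)))))))))"
    unfolding dual_sweedler_sum dual_sweedler_swap dual_sweedler_mult_left dual_sweedler_eval[OF fg(2)]
    by (simp add: mult.assoc)
  also have "\<dots> = (\<Sum>i\<in>basis. sweedler i (\<lambda>s t. sweedler a (\<lambda>a' a''. sweedler a'' (\<lambda>x w. sweedler w (\<lambda>y z.
        sweedler a' (\<lambda>p q. f s * F (coord i) (y * b) * g (S z * (x * (S q * (t * p)))))))))) "
    unfolding sweedler_sum by (rule sum.cong[OF refl], rule sweedler_swap)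
  also have "\<dots> = (\<Sum>i\<in>basis. sweedler i (\<lambda>s t. f s * sweedler a (\<lambda>a' a''. sweedler a'' (\<lambda>x w. sweedler w (\<lambda>y z.
        sweedler a' (\<lambda>p q. g (S z * (x * (S q * (t * p))))) * F (coord i) (y * b))))))"
    by (simp add: sweedler_mult_left[symmetric] sweedler_mult_right[symmetric] ac_simps)
  also have "\<dots> = (\<Sum>i\<in>basis. sweedler i (\<lambda>s t. f s * sweedler a (\<lambda>x w. sweedler w (\<lambda>y z. g (S z * (t * x)) * F (coord i) (y * b)))))"
    by (rule sum.cong[OF refl], rule sweedler_cong) (simp only: key[OF lF])
  also have "\<dots> = (\<Sum>i\<in>basis. sweedler a (\<lambda>x w. sweedler w (\<lambda>y z. sweedler i (\<lambda>s t. f s * g (S z * (t * x)) * F (coord i) (y * b)))))"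
  proof (rule sum.cong[OF refl])
    fix i
    show "sweedler i (\<lambda>s t. f s * sweedler a (\<lambda>x w. sweedler w (\<lambda>y z. g (S z * (t * x)) * F (coord i) (y * b)))) =
      sweedler a (\<lambda>x w. sweedler w (\<lambda>y z. sweedler i (\<lambda>s t. f s * g (S z * (t * x)) * F (coord i) (y * b))))"
      unfolding sweedler_mult_left[symmetric] mult.assoc
      by (subst sweedler_swap, rule sweedler_cong, rule sweedler_swap)
  qed
  also have "\<dots> = sweedler a (\<lambda>x w. sweedler w (\<lambda>y z. \<Sum>i\<in>basis. dual_mult f (twisted g x z) i * F (coord i) (y * b)))"
    by (simp add: sweedler_sum dual_mult_def twisted_def sweedler_mult_right[symmetric] mult.assoc)
  also have "\<dots> = sweedler a (\<lambda>x w. sweedler w (\<lambda>y z. F (dual_mult f (twisted g x z)) (y * b)))"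
    by (simp add: Fe[OF dual_mult_mem[OF fg(1) twisted_mem[OF fg(2)]]])
  finally show ?thesis .
qed

lemma double_mult_mem:
  assumes "x \<in> vecs double" "y \<in> vecs double"
  shows "double_mult x y \<in> vecs double"
  unfolding double_mult_def double_def
proof (rule tensor_sum_mem, use assms(1) in \<open>simp add: double_def\<close>,
    rule tensor_sum_mem, use assms(2) in \<open>simp add: double_def\<close>)
  fix f g :: "'h \<Rightarrow> 'k" and a b assume f: "f \<in> vecs H_dual" and g: "g \<in> vecs H_dual"
  show "sweedler a (\<lambda>a' a''. dual_sweedler g (\<lambda>g' g''.
       pure_tensor H_dual H (dual_mult f (a' \<rhd> g')) ((a'' \<lhd> g'') * b))) \<in> vecs (tensor_space H_dual H)"
    unfolding sweedler_def dual_sweedler_def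
    by (intro tensor_sum_mem comult_mem dual_comult_mem g pure_tensor_mem dual_mult_mem f act_on_dual_mem) auto
qed

lemma double_mult_apply:
  assumes xy: "x \<in> vecs double" "y \<in> vecs double" and F: "bilinear_map H_dual H scalars F"
  shows "double_mult x y F = tensor_sum H_dual H x (\<lambda>f a. tensor_sum H_dual H y (\<lambda>g b.
     sweedler a (\<lambda>p w. sweedler w (\<lambda>q r. F (dual_mult f (twisted g p r)) (q * b)))))"
proof -
  have "double_mult x y F = tensor_sum H_dual H x (\<lambda>f a. tensor_sum H_dual H y (\<lambda>g b.
     sweedler a (\<lambda>a' a''. dual_sweedler g (\<lambda>g' g''. F (dual_mult f (a' \<rhd> g')) ((a'' \<lhd> g'') * b)))))"
    by (simp add: double_mult_def tensor_sum_fun_apply sweedler_fun_apply dual_sweedler_fun_apply)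
      (simp add: pure_tensor_def F)
  also have "\<dots> = tensor_sum H_dual H x (\<lambda>f a. tensor_sum H_dual H y (\<lambda>g b.
     sweedler a (\<lambda>p w. sweedler w (\<lambda>q r. F (dual_mult f (twisted g p r)) (q * b)))))"
    by (intro tensor_sum_cong xy[unfolded double_def] double_mult_term F)
  finally show ?thesis .
qed

text \<open>The list chosen for a pure tensor need not be the obvious one, so both outer sums
  collapse only after \<open>?K\<close> is shown bilinear in each factor. The form \<open>K\<close>
  over the dual basis makes the dependence on the functionals visibly linear.\<close>

lemma double_mult_pure_apply:
  assumes F: "bilinear_map H_dual H scalars F" and fg: "f \<in> vecs H_dual" "g \<in> vecs H_dual"
  shows "double_mult (pure_tensor H_dual H f a) (pure_tensor H_dual H g b) F =
     sweedler a (\<lambda>p w. sweedler w (\<lambda>q r. F (dual_mult f (twisted g p r)) (q * b)))"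
proof -
  let ?K = "\<lambda>f a g b. sweedler a (\<lambda>p w. sweedler w (\<lambda>q r. F (dual_mult f (twisted g p r)) (q * b)))"
  have Fe: "F u x = (\<Sum>i\<in>basis. u i * F (coord i) x)" if "u \<in> vecs H_dual" for u x
    using F that by (intro linear_map_dual_expand) (auto simp: bilinear_map_dual_H_iff)
  have lF: "lin sH (F (coord i))" if "i \<in> basis" for i
    using F coord_mem[OF that] by (simp add: bilinear_map_dual_H_iff)
  have K: "?K f a g b = (\<Sum>i\<in>basis. sweedler a (\<lambda>p w. sweedler w (\<lambda>q r.
      sweedler i (\<lambda>s t. f s * g (S r * t * p)) * F (coord i) (q * b))))"
    if "f \<in> vecs H_dual" "g \<in> vecs H_dual" for f a g b
    by (simp add: Fe[OF dual_mult_mem[OF that(1) twisted_mem[OF that(2)]]] sweedler_sum)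
      (simp add: dual_mult_def twisted_def)
  have p: "pure_tensor H_dual H f a \<in> vecs double" "pure_tensor H_dual H g b \<in> vecs double"
    using fg by (auto simp: double_def intro: pure_tensor_mem)
  have vs: "f + f' \<in> vecs H_dual" "smul H_dual c f \<in> vecs H_dual"
    if "f \<in> vecs H_dual" "f' \<in> vecs H_dual" for f f' c
    using that by (simp_all add: vecs_dual_space smul_dual_space lin_def algebra_simps)
  have Kg: "bilinear_map H_dual H scalars (\<lambda>g b. ?K f a g b)" if f: "f \<in> vecs H_dual" for f a
    unfolding bilinear_map_dual_H_iff
  proof (intro conjI ballI allI)
    fix g assume g: "g \<in> vecs H_dual"
    show "lin sH (?K f a g)"
      unfolding K[OF f g]
      using lF by (simp add: lin_simps mult.left_commute sum.distrib[symmetric] sum_distrib_left cong: sum.cong)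
  next
    fix b
    show "linear_map H_dual scalars (\<lambda>g. ?K f a g b)"
      unfolding linear_map_def
      by (auto simp: K f vs vs(2)[unfolded smul_dual_space] sum.distrib[symmetric] sum_distrib_left smul_dual_space distrib_left distrib_right sweedler_add
          sweedler_mult_left[symmetric] sweedler_mult_right[symmetric] ac_simps)
  qed
  have Kf: "bilinear_map H_dual H scalars (\<lambda>f a. ?K f a g b)"
    unfolding bilinear_map_dual_H_iff
  proof (intro conjI ballI allI)
    fix f assume f: "f \<in> vecs H_dual"
    have lg: "lin sH g" using fg by (simp add: vecs_dual_space)
    have "lin sH (\<lambda>a. sweedler a (\<lambda>p w. sweedler w (\<lambda>q r.
      sweedler i (\<lambda>s t. f s * g (S r * t * p)) * F (coord i) (q * b))))" if "i \<in> basis" for i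
      by (rule lin_sweedler) (use lF[OF that] lg in \<open>simp add: lin_simps mult.assoc mult.left_commute\<close>)
    thus "lin sH (\<lambda>a. ?K f a g b)"
      unfolding K[OF f fg(2)]
      by (simp add: lin_def sum.distrib[symmetric] sum_distrib_left cong: sum.cong)
  next
    fix a
    show "linear_map H_dual scalars (\<lambda>f. ?K f a g b)"
      unfolding linear_map_def
      by (auto simp: K fg vs vs(2)[unfolded smul_dual_space] sum.distrib[symmetric] sum_distrib_left smul_dual_space distrib_left distrib_right sweedler_add
          sweedler_mult_left[symmetric] sweedler_mult_right[symmetric] ac_simps)
  qed
  have "tensor_sum H_dual H (pure_tensor H_dual H g b) (\<lambda>g b. ?K f a g b) = ?K f a g b"
    if "f \<in> vecs H_dual" for f a
    using fg(2) by (intro tensor_universal(2)[OF is_vspace_dual_space is_vspace_scalars Kg[OF that]]) auto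
  hence "double_mult (pure_tensor H_dual H f a) (pure_tensor H_dual H g b) F =
      tensor_sum H_dual H (pure_tensor H_dual H f a) (\<lambda>f a. ?K f a g b)"
    unfolding double_mult_apply[OF p F]
    by (intro tensor_sum_cong p[unfolded double_def])
  also have "\<dots> = ?K f a g b"
    using fg(1) by (intro tensor_universal(2)[OF is_vspace_dual_space is_vspace_scalars Kf]) auto
  finally show ?thesis .
qed

end

section \<open>Modules over the quantum double\<close>

context fd_biperfect_space
begin

section \<open>Comodules as modules over the dual\<close>

definition dual_action ::
    "('v \<Rightarrow> ('v \<Rightarrow> 'h \<Rightarrow> 'k) \<Rightarrow> 'k) \<Rightarrow> ('h \<Rightarrow> 'k) \<Rightarrow> 'v \<Rightarrow> 'v" where
  "dual_action \<delta> f \<beta> = dsum \<delta> \<beta> (\<lambda>v h. sV (f h) v)"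

lemma dual_action_lin: "lin sV \<phi> \<Longrightarrow> \<phi> (dual_action \<delta> f \<beta>) = dsum \<delta> \<beta> (\<lambda>v h. f h * \<phi> v)"
  by (simp add: dual_action_def dsum_lin lin_scale)

lemma bilinear_map_form: "lin sV \<phi> \<Longrightarrow> lin sH f \<Longrightarrow> bilinear_map V H scalars (\<lambda>v h. f h * \<phi> v)"
  by (simp add: lin_simps mult.left_commute)

text \<open>Expanding the argument from H in the basis expresses sums over the coaction by actions
  of functionals. The map \<open>k\<close> allows for the substitution \<open>h\<close> to
  \<open>S z * h * x\<close>.\<close>

lemma dsum_expand_fun:
  assumes B: "bilinear_map V H scalars B"
  shows "dsum \<delta> \<beta> (\<lambda>v h. B v (k h)) = (\<Sum>i\<in>basis. B (dual_action \<delta> (\<lambda>h. coord i (k h)) \<beta>) i)"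
proof -
  have B1: "lin sV (\<lambda>v. B v i)" and B2: "lin sH (B v)" for v i
    using B by (auto simp: bilinear_map_full_iff)
  have "dsum \<delta> \<beta> (\<lambda>v h. B v (k h)) = dsum \<delta> \<beta> (\<lambda>v h. \<Sum>i\<in>basis. coord i (k h) * B v i)"
    by (simp only: lin_expand[OF B2, symmetric])
  thus ?thesis by (simp add: tensor_sum_sum dual_action_lin[OF B1])
qed

lemma dsum_expand:
  "bilinear_map V H scalars B \<Longrightarrow> dsum \<delta> \<beta> B = (\<Sum>i\<in>basis. B (dual_action \<delta> (coord i) \<beta>) i)"
  using dsum_expand_fun[of B \<delta> \<beta> "\<lambda>h. h"] by simp

text \<open>A bilinear form summed over the coaction depends only on the actions of the functionals
  \<open>coord i\<close>.\<close>

lemma coaction_eqI: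
  assumes \<delta>: "linear_map V (tensor_space V H) \<delta>" "linear_map V (tensor_space V H) \<delta>'"
    and eq: "\<And>f \<beta>. f \<in> vecs H_dual \<Longrightarrow> dual_action \<delta> f \<beta> = dual_action \<delta>' f \<beta>"
  shows "\<delta> = \<delta>'"
proof
  fix \<beta>
  have m: "\<delta> \<beta> \<in> vecs (tensor_space V H)" "\<delta>' \<beta> \<in> vecs (tensor_space V H)"
    using \<delta> by (auto simp: linear_map_def)
  show "\<delta> \<beta> = \<delta>' \<beta>"
  proof (rule tensor_eqI[OF m])
    fix B assume B: "bilinear_map V H scalars B"
    show "\<delta> \<beta> B = \<delta>' \<beta> B"
      unfolding tensor_apply[OF B m(1)] tensor_apply[OF B m(2)]
        dsum_expand[OF B, of \<delta>] dsum_expand[OF B, of \<delta>']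
      by (rule sum.cong) (simp_all add: eq coord_mem)
  qed
qed

lemma dual_action_linear:
  assumes \<delta>: "linear_map V (tensor_space V H) \<delta>" and f: "f \<in> vecs H_dual"
  shows "dual_action \<delta> f (\<beta> + \<gamma>) = dual_action \<delta> f \<beta> + dual_action \<delta> f \<gamma>"
    and "dual_action \<delta> f (sV c \<beta>) = sV c (dual_action \<delta> f \<beta>)"
proof -
  have f': "lin sH f" using f by (simp add: vecs_dual_space)
  show "dual_action \<delta> f (\<beta> + \<gamma>) = dual_action \<delta> f \<beta> + dual_action \<delta> f \<gamma>"
  proof (rule vector_eqI[OF V.vector_space_axioms])
    fix \<phi> assume p: "lin sV \<phi>"
    show "\<phi> (dual_action \<delta> f (\<beta> + \<gamma>)) = \<phi> (dual_action \<delta> f \<beta> + dual_action \<delta> f \<gamma>)"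
      by (simp add: lin_add[OF p] dual_action_lin[OF p] dsum_add[OF \<delta> bilinear_map_form[OF p f']])
  qed
  show "dual_action \<delta> f (sV c \<beta>) = sV c (dual_action \<delta> f \<beta>)"
  proof (rule vector_eqI[OF V.vector_space_axioms])
    fix \<phi> assume p: "lin sV \<phi>"
    show "\<phi> (dual_action \<delta> f (sV c \<beta>)) = \<phi> (sV c (dual_action \<delta> f \<beta>))"
      by (simp add: lin_scale[OF p] dual_action_lin[OF p] dsum_add[OF \<delta> bilinear_map_form[OF p f']])
  qed
qed

lemma dual_action_linear_dual:
  "dual_action \<delta> (f + g) \<beta> = dual_action \<delta> f \<beta> + dual_action \<delta> g \<beta>"
  "dual_action \<delta> (\<lambda>x. c * f x) \<beta> = sV c (dual_action \<delta> f \<beta>)"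
proof -
  show "dual_action \<delta> (f + g) \<beta> = dual_action \<delta> f \<beta> + dual_action \<delta> g \<beta>"
    by (simp add: dual_action_def V.scale_left_distrib tensor_sum_add)
  have "sV c (dsum \<delta> \<beta> (\<lambda>v h. sV (f h) v)) = dsum \<delta> \<beta> (\<lambda>v h. sV c (sV (f h) v))"
    by (rule tensor_sum_hom) (simp_all add: V.scale_right_distrib)
  thus "dual_action \<delta> (\<lambda>x. c * f x) \<beta> = sV c (dual_action \<delta> f \<beta>)"
    by (simp add: dual_action_def)
qed

text \<open>Coassociativity of the comodule is dual to associativity for convolution: the coaction
  applied second supplies the first leg, so \<open>g\<close> acts before \<open>f\<close>.\<close>

lemma dual_action_mult:
  assumes \<delta>: "linear_map V (tensor_space V H) \<delta>"
    and co: "coaction_coassoc \<delta>" and fg: "f \<in> vecs H_dual" "g \<in> vecs H_dual"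
  shows "dual_action \<delta> (dual_mult f g) \<beta> = dual_action \<delta> f (dual_action \<delta> g \<beta>)"
proof (rule vector_eqI[OF V.vector_space_axioms])
  fix \<phi> assume p: "lin sV \<phi>"
  have fg': "lin sH f" "lin sH g" using fg by (simp_all add: vecs_dual_space)
  have p': "lin sV (\<lambda>\<gamma>. \<phi> (dual_action \<delta> f \<gamma>))"
    using p by (simp add: lin_def dual_action_linear[OF \<delta> fg(1)])
  have "\<phi> (dual_action \<delta> f (dual_action \<delta> g \<beta>)) = dsum \<delta> \<beta> (\<lambda>v h. g h * \<phi> (dual_action \<delta> f v))"
    by (rule dual_action_lin[OF p'])
  also have "\<dots> = dsum \<delta> \<beta> (\<lambda>v h. dsum \<delta> v (\<lambda>v' h'. f h' * g h * \<phi> v'))"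
    by (simp add: dual_action_lin[OF p] tensor_sum_mult_left[symmetric] ac_simps)
  also have "\<dots> = dsum \<delta> \<beta> (\<lambda>v h. sweedler h (\<lambda>x y. f x * g y * \<phi> v))"
    by (rule co[unfolded coaction_coassoc_def, rule_format])
      (use p fg' in \<open>simp add: lin_simps mult.left_commute\<close>)
  also have "\<dots> = \<phi> (dual_action \<delta> (dual_mult f g) \<beta>)"
    by (simp add: dual_action_lin[OF p] dual_mult_def sweedler_mult_right)
  finally show "\<phi> (dual_action \<delta> (dual_mult f g) \<beta>) = \<phi> (dual_action \<delta> f (dual_action \<delta> g \<beta>))" ..
qed

lemma double_action_eq:
  "x \<in> vecs double \<Longrightarrow>
    double_action sV \<mu> \<delta> x \<beta> = tensor_sum H_dual H x (\<lambda>f a. dual_action \<delta> f (\<mu> a \<beta>))"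
  by (simp add: double_action_def dual_action_def)

lemma is_vspace_V: "is_vspace V"
  by (rule is_vspace_full_space[OF V.vector_space_axioms])

lemma bilinear_dual_action:
  assumes \<mu>: "bilinear_map H V V \<mu>" and \<delta>: "linear_map V (tensor_space V H) \<delta>"
  shows "bilinear_map H_dual H V (\<lambda>f a. dual_action \<delta> f (\<mu> a \<beta>))"
  using \<mu>[unfolded bilinear_map_V_iff]
  by (simp add: bilinear_map_def linear_map_def dual_action_linear[OF \<delta>] dual_action_linear_dual smul_dual_space
      del: plus_fun_apply)

lemma double_action_pure:
  assumes \<mu>: "bilinear_map H V V \<mu>" and \<delta>: "linear_map V (tensor_space V H) \<delta>"
    and f: "f \<in> vecs H_dual"
  shows "double_action sV \<mu> \<delta> (pure_tensor H_dual H f a) \<beta> = dual_action \<delta> f (\<mu> a \<beta>)"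
proof -
  have "pure_tensor H_dual H f a \<in> vecs double"
    using f by (auto simp: double_def intro: pure_tensor_mem)
  thus ?thesis
    using f by (simp add: double_action_eq
      tensor_universal(2)[OF is_vspace_dual_space is_vspace_V bilinear_dual_action[OF \<mu> \<delta>]])
qed

lemma counit_mem: "\<epsilon> \<in> vecs H_dual"
  by (simp add: vecs_dual_space lin_counit)

lemma double_closed:
  "x \<in> vecs double \<Longrightarrow> y \<in> vecs double \<Longrightarrow> x + y \<in> vecs double"
  "x \<in> vecs double \<Longrightarrow> smul double c x \<in> vecs double"
  unfolding double_def by (rule tensor_space_add, assumption+, rule tensor_space_scale[OF is_vspace_dual_space])

lemma lin_bilinear: "lin s \<phi> \<Longrightarrow> bilinear_map A B (full_space s) F \<Longrightarrow> bilinear_map A B scalars (\<lambda>u v. \<phi> (F u v))"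
  by (simp add: bilinear_map_def linear_map_def lin_def)

lemma double_module_of_crossed:
  assumes c: "crossed_bimodule sV \<mu> \<delta>" and t: "twist_condition sV \<mu> \<delta>"
  shows "double_module sV (double_action sV \<mu> \<delta>)"
proof -
  have M: "left_module H (*) 1 V \<mu>" and \<delta>: "linear_map V (tensor_space V H) \<delta>"
    and co: "coaction_coassoc \<delta>" and cu: "dual_action \<delta> \<epsilon> \<beta> = \<beta>" for \<beta>
    using c by (auto simp: crossed_bimodule_iff dual_action_def)
  have \<mu>: "bilinear_map H V V \<mu>" and \<mu>1: "\<mu> 1 \<beta> = \<beta>" and \<mu>m: "\<mu> (a * b) \<beta> = \<mu> a (\<mu> b \<beta>)" for a b \<beta>
    using M by (auto simp: left_module_def)
  note \<mu>_lin = \<mu>[unfolded bilinear_map_V_iff]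
  have D: "double_compat \<mu> \<delta>"
    using c t by (simp add: double_compat_iff[OF \<mu> \<delta>] crossed_bimodule_iff twist_condition_iff)
  let ?act = "double_action sV \<mu> \<delta>"
  have bil: "bilinear_map double V V ?act"
    unfolding bilinear_map_def
  proof (intro conjI ballI)
    fix x assume x: "x \<in> vecs double"
    note xd = x[unfolded double_def]
    have "?act x (\<beta> + \<gamma>) = ?act x \<beta> + ?act x \<gamma>" for \<beta> \<gamma>
      unfolding double_action_eq[OF x] tensor_sum_add[symmetric]
      by (rule tensor_sum_cong[OF xd]) (simp add: \<mu>_lin dual_action_linear[OF \<delta>])
    moreover have "?act x (sV c \<beta>) = sV c (?act x \<beta>)" for c \<beta>
    proof -
      have "?act x (sV c \<beta>) = tensor_sum H_dual H x (\<lambda>f a. sV c (dual_action \<delta> f (\<mu> a \<beta>)))"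
        unfolding double_action_eq[OF x]
        by (rule tensor_sum_cong[OF xd]) (simp add: \<mu>_lin dual_action_linear[OF \<delta>])
      also have "\<dots> = sV c (?act x \<beta>)"
        unfolding double_action_eq[OF x]
        by (rule tensor_sum_hom[symmetric]) (simp_all add: V.scale_right_distrib)
      finally show ?thesis .
    qed
    ultimately show "linear_map V V (?act x)" by (simp add: linear_map_def)
  next
    fix \<beta>
    have "linear_map double V (\<lambda>x. tensor_sum H_dual H x (\<lambda>f a. dual_action \<delta> f (\<mu> a \<beta>)))"
      unfolding double_def
      by (rule tensor_universal(1)[OF is_vspace_dual_space is_vspace_V bilinear_dual_action[OF \<mu> \<delta>]])
    thus "linear_map double V (\<lambda>x. ?act x \<beta>)"
      unfolding linear_map_def by (simp add: double_action_eq double_closed del: plus_fun_apply)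
  qed
  \<comment> \<open>The rule for moving \<open>a\<close> past \<open>g\<close>:
    \<open>double_compat\<close> at the form \<open>g h * \<psi> v\<close>, after which
    \<open>f\<close> and the twisted functional merge into one convolution product.\<close>
  have key: "\<phi> (dual_action \<delta> f (\<mu> a (dual_action \<delta> g \<gamma>))) =
      sweedler a (\<lambda>p w. sweedler w (\<lambda>q r. \<phi> (dual_action \<delta> (dual_mult f (twisted g p r)) (\<mu> q \<gamma>))))"
    if p: "lin sV \<phi>" and fg: "f \<in> vecs H_dual" "g \<in> vecs H_dual" for \<phi> f g a \<gamma>
  proof -
    define \<psi> where "\<psi> = (\<lambda>\<gamma>. \<phi> (dual_action \<delta> f \<gamma>))"
    have \<psi>: "lin sV \<psi>" using p by (simp add: \<psi>_def lin_def dual_action_linear[OF \<delta> fg(1)])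
    hence \<psi>a: "lin sV (\<lambda>\<gamma>. \<psi> (\<mu> a \<gamma>))" by (simp add: lin_def \<mu>_lin)
    have g: "lin sH g" using fg by (simp add: vecs_dual_space)
    have "\<psi> (\<mu> a (dual_action \<delta> g \<gamma>)) = dsum \<delta> \<gamma> (\<lambda>v h. g h * \<psi> (\<mu> a v))"
      by (rule dual_action_lin[OF \<psi>a])
    also have "\<dots> = sweedler a (\<lambda>p w. sweedler w (\<lambda>q r. dsum \<delta> (\<mu> q \<gamma>) (\<lambda>v h. g (S r * h * p) * \<psi> v)))"
      using D[unfolded double_compat_def, rule_format, OF bilinear_map_form[OF \<psi> g]] .
    also have "\<dots> = sweedler a (\<lambda>p w. sweedler w (\<lambda>q r. \<psi> (dual_action \<delta> (twisted g p r) (\<mu> q \<gamma>))))"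
      by (simp add: dual_action_lin[OF \<psi>] twisted_def)
    finally show ?thesis
      by (simp add: \<psi>_def dual_action_mult[OF \<delta> co fg(1) twisted_mem[OF fg(2)]])
  qed
  have "?act (double_mult x y) \<beta> = ?act x (?act y \<beta>)" if x: "x \<in> vecs double" and y: "y \<in> vecs double" for x y \<beta>
  proof (rule vector_eqI[OF V.vector_space_axioms])
    fix \<phi> assume p: "lin sV \<phi>"
    let ?F = "\<lambda>f a. \<phi> (dual_action \<delta> f (\<mu> a \<beta>))"
    have F: "bilinear_map H_dual H scalars ?F"
      by (rule lin_bilinear[OF p bilinear_dual_action[OF \<mu> \<delta>]])
    have push: "\<phi> (tensor_sum H_dual H z G) = tensor_sum H_dual H z (\<lambda>f a. \<phi> (G f a))" for z G
      using p by (intro tensor_sum_hom) (auto simp: lin_zero lin_add)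
    note m = double_mult_mem[OF x y]
    \<comment> \<open>The action of a tensor is its value at the matrix coefficient
      \<open>?F\<close>, so the product formula can be applied with \<open>?F\<close> as test
      form.\<close>
    have "\<phi> (?act (double_mult x y) \<beta>) = double_mult x y ?F"
      unfolding double_action_eq[OF m] push by (rule tensor_apply[OF F m[unfolded double_def], symmetric])
    also have "\<dots> = tensor_sum H_dual H x (\<lambda>f a. tensor_sum H_dual H y (\<lambda>g b.
        sweedler a (\<lambda>p w. sweedler w (\<lambda>q r. ?F (dual_mult f (twisted g p r)) (q * b)))))"
      by (rule double_mult_apply[OF x y F])
    also have "\<dots> = tensor_sum H_dual H x (\<lambda>f a. tensor_sum H_dual H y (\<lambda>g b.
        \<phi> (dual_action \<delta> f (\<mu> a (dual_action \<delta> g (\<mu> b \<beta>))))))"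
      by (intro tensor_sum_cong x[unfolded double_def] y[unfolded double_def]) (simp add: key[OF p] \<mu>m)
    also have "\<dots> = tensor_sum H_dual H x (\<lambda>f a. \<phi> (dual_action \<delta> f (\<mu> a (?act y \<beta>))))"
    proof (rule tensor_sum_cong[OF x[unfolded double_def]])
      fix f a assume f: "f \<in> vecs H_dual"
      have "lin sV (\<lambda>\<gamma>. \<phi> (dual_action \<delta> f (\<mu> a \<gamma>)))"
        using p by (simp add: lin_def \<mu>_lin dual_action_linear[OF \<delta> f])
      thus "tensor_sum H_dual H y (\<lambda>g b. \<phi> (dual_action \<delta> f (\<mu> a (dual_action \<delta> g (\<mu> b \<beta>))))) =
         \<phi> (dual_action \<delta> f (\<mu> a (?act y \<beta>)))"
        unfolding double_action_eq[OF y]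
        by (intro tensor_sum_hom[symmetric]) (auto dest: lin_zero lin_add)
    qed
    also have "\<dots> = \<phi> (?act x (?act y \<beta>))"
      by (simp add: double_action_eq[OF x] push)
    finally show "\<phi> (?act (double_mult x y) \<beta>) = \<phi> (?act x (?act y \<beta>))" .
  qed
  moreover have "?act double_one \<beta> = \<beta>" for \<beta>
    by (simp add: double_one_def double_action_pure[OF \<mu> \<delta> counit_mem] \<mu>1 cu)
  ultimately show ?thesis using bil by (simp add: double_module_def left_module_def)
qed

text \<open>Both structures can be read off: \<epsilon> \<infinity> a acts as \<open>\<mu> a\<close>
  by the counit axiom, and f \<infinity> 1 acts as \<open>dual_action\<close> of \<open>f\<close>,
  which determines the coaction.\<close>

lemma double_action_inj:
  assumes c: "crossed_bimodule sV \<mu> \<delta>" "crossed_bimodule sV \<mu>' \<delta>'"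
    and eq: "double_action sV \<mu> \<delta> = double_action sV \<mu>' \<delta>'"
  shows "\<mu> = \<mu>' \<and> \<delta> = \<delta>'"
proof -
  have \<mu>: "bilinear_map H V V \<mu>" "bilinear_map H V V \<mu>'"
    and \<delta>: "linear_map V (tensor_space V H) \<delta>" "linear_map V (tensor_space V H) \<delta>'"
    and cu: "dual_action \<delta> \<epsilon> \<beta> = \<beta>" "dual_action \<delta>' \<epsilon> \<beta> = \<beta>"
    and one: "\<mu> 1 \<beta> = \<beta>" "\<mu>' 1 \<beta> = \<beta>" for \<beta>
    using c by (auto simp: crossed_bimodule_iff dual_action_def left_module_def)
  have *: "dual_action \<delta> f (\<mu> a \<beta>) = dual_action \<delta>' f (\<mu>' a \<beta>)" if "f \<in> vecs H_dual" for f a \<beta>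
    using double_action_pure[OF \<mu>(1) \<delta>(1) that, of a \<beta>] double_action_pure[OF \<mu>(2) \<delta>(2) that, of a \<beta>] eq
    by simp
  have "\<mu> = \<mu>'" using *[OF counit_mem] by (simp add: cu fun_eq_iff)
  moreover have "\<delta> = \<delta>'"
    by (rule coaction_eqI[OF \<delta>]) (use *[of _ 1] in \<open>simp add: one\<close>)
  ultimately show ?thesis ..
qed

end

section \<open>The crossed bimodule of a module over the quantum double\<close>

context fd_biperfect
begin

section \<open>The two subalgebras of the double\<close>

lemma sweedler_one:
  "bilinear_map H H scalars F \<Longrightarrow> sweedler 1 F = F 1 1"
  by (simp add: sweedler_eq_apply comult_one pure_tensor_def)

lemma sweedler_counit:
  assumes k: "lin sH k"
  shows "sweedler a (\<lambda>p w. \<epsilon> p * k w) = k a" "sweedler a (\<lambda>p w. k p * \<epsilon> w) = k a"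
  using sweedler_lin[OF k, of a "\<lambda>x' x''. sH (\<epsilon> x') x''"]
    sweedler_lin[OF k, of a "\<lambda>x' x''. sH (\<epsilon> x'') x'"]
  by (simp_all add: sweedler_def counit_left counit_right lin_scale[OF k] mult.commute)

lemma counit_S: "\<epsilon> (S x) = \<epsilon> x"
proof -
  have "\<epsilon> (T (S x)) = \<epsilon> (S x)" using perfect by (simp only: perfect_def anti_bialgebra_morphism_def)
  thus ?thesis by simp
qed

lemma dual_mult_counit:
  assumes "f \<in> vecs H_dual"
  shows "dual_mult \<epsilon> f = f" "dual_mult f \<epsilon> = f"
  using assms by (simp_all add: dual_mult_def vecs_dual_space sweedler_counit)

lemma dual_mult_twisted_counit:
  "dual_mult f (twisted \<epsilon> p r) = (\<lambda>x. \<epsilon> p * \<epsilon> r * dual_mult f \<epsilon> x)"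
  by (simp add: dual_mult_def twisted_def counit_mult counit_S sweedler_mult_left[symmetric] ac_simps)

text \<open>The coproduct of 1 is 1 \<otimes> 1 and \<open>S 1 = 1\<close>, so the twist disappears.
  With \<open>b\<close> equal to 1 this embeds the convolution algebra.\<close>

lemma double_mult_pure_one:
  assumes F: "bilinear_map H_dual H scalars F" and fg: "f \<in> vecs H_dual" "g \<in> vecs H_dual"
  shows "double_mult (pure_tensor H_dual H f 1) (pure_tensor H_dual H g b) F = F (dual_mult f g) b"
proof -
  have Fe: "F u x = (\<Sum>i\<in>basis. u i * F (coord i) x)" if "u \<in> vecs H_dual" for u x
    using F that by (intro linear_map_dual_expand) (auto simp: bilinear_map_dual_H_iff)
  have lF: "lin sH (F (coord i))" if "i \<in> basis" for i
    using F coord_mem[OF that] by (simp add: bilinear_map_dual_H_iff)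
  have g: "lin sH g" using fg by (simp add: vecs_dual_space)
  have "double_mult (pure_tensor H_dual H f 1) (pure_tensor H_dual H g b) F =
     (\<Sum>i\<in>basis. sweedler 1 (\<lambda>p w. sweedler w (\<lambda>q r.
      sweedler i (\<lambda>s t. f s * g (S r * t * p)) * F (coord i) (q * b))))"
    unfolding double_mult_pure_apply[OF F fg]
    by (simp add: Fe[OF dual_mult_mem[OF fg(1) twisted_mem[OF fg(2)]]] sweedler_sum)
      (simp add: dual_mult_def twisted_def)
  also have "\<dots> = (\<Sum>i\<in>basis. dual_mult f g i * F (coord i) b)"
  proof (rule sum.cong[OF refl])
    fix i assume i: "i \<in> basis"
    have "sweedler 1 (\<lambda>p w. sweedler w (\<lambda>q r.
      sweedler i (\<lambda>s t. f s * g (S r * t * p)) * F (coord i) (q * b))) =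
      sweedler 1 (\<lambda>q r. sweedler i (\<lambda>s t. f s * g (S r * t * 1)) * F (coord i) (q * b))"
      by (rule sweedler_one) (use lF[OF i] g in \<open>simp add: lin_simps mult.assoc mult.left_commute\<close>)
    also have "\<dots> = sweedler i (\<lambda>s t. f s * g (S 1 * t * 1)) * F (coord i) (1 * b)"
      by (rule sweedler_one) (use lF[OF i] g in \<open>simp add: lin_simps mult.assoc mult.left_commute\<close>)
    finally show "sweedler 1 (\<lambda>p w. sweedler w (\<lambda>q r.
      sweedler i (\<lambda>s t. f s * g (S r * t * p)) * F (coord i) (q * b))) = dual_mult f g i * F (coord i) b"
      by (simp add: S_one dual_mult_def)
  qed
  also have "\<dots> = F (dual_mult f g) b"
    by (rule Fe[OF dual_mult_mem[OF fg], symmetric])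
  finally show ?thesis .
qed

text \<open>A multiplicative counit that \<open>S\<close> preserves turns the twist into scalars,
  which the counit axioms absorb. With \<open>f\<close> equal to \<epsilon> this embeds H.\<close>

lemma double_mult_pure_counit:
  assumes F: "bilinear_map H_dual H scalars F" and f: "f \<in> vecs H_dual"
  shows "double_mult (pure_tensor H_dual H f a) (pure_tensor H_dual H \<epsilon> b) F = F f (a * b)"
proof -
  have e: "\<epsilon> \<in> vecs H_dual" by (simp add: vecs_dual_space lin_counit)
  have k: "lin sH (\<lambda>q. F f (q * b))"
    using F f by (simp add: bilinear_map_dual_H_iff lin_simps)
  have sc: "F (\<lambda>x. c * f x) u = c * F f u" for c u
    using F f by (simp add: bilinear_map_def linear_map_def smul_dual_space)
  have "double_mult (pure_tensor H_dual H f a) (pure_tensor H_dual H \<epsilon> b) F =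
    sweedler a (\<lambda>p w. sweedler w (\<lambda>q r. \<epsilon> p * (F f (q * b) * \<epsilon> r)))"
    unfolding double_mult_pure_apply[OF F f e] dual_mult_twisted_counit dual_mult_counit(2)[OF f] sc
    by (simp add: ac_simps)
  thus ?thesis by (simp add: sweedler_mult_left sweedler_counit[OF k])
qed

end

context fd_biperfect_space
begin

context
  fixes act
  assumes act: "double_module sV act"
begin

section \<open>Action and coaction read off a module\<close>

abbreviation (input) pure where "pure \<equiv> pure_tensor H_dual H"

definition module_action :: "'h \<Rightarrow> 'v \<Rightarrow> 'v" where
  "module_action a \<beta> = act (pure \<epsilon> a) \<beta>"

definition module_dual_action :: "('h \<Rightarrow> 'k) \<Rightarrow> 'v \<Rightarrow> 'v" where
  "module_dual_action f \<beta> = act (pure f 1) \<beta>"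

text \<open>The canonical element of the dual tensor H applied to \<open>\<beta>\<close>: the
  standard passage from a module over a finite dimensional dual to a comodule.\<close>

definition module_coaction :: "'v \<Rightarrow> ('v \<Rightarrow> 'h \<Rightarrow> 'k) \<Rightarrow> 'k" where
  "module_coaction \<beta> = (\<Sum>b\<in>basis. pure_tensor V H (module_dual_action (coord b) \<beta>) b)"

lemma act_bilinear: "bilinear_map double V V act"
  and act_one: "act double_one \<beta> = \<beta>"
  and act_mult: "x \<in> vecs double \<Longrightarrow> y \<in> vecs double \<Longrightarrow> act (double_mult x y) \<beta> = act x (act y \<beta>)"
  using act by (auto simp: double_module_def left_module_def)

lemma pure_mem: "f \<in> vecs H_dual \<Longrightarrow> pure f a \<in> vecs double"
  by (auto simp: double_def intro: pure_tensor_mem)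

lemma act_pure_bilinear: "bilinear_map H_dual H V (\<lambda>f a. act (pure f a) \<beta>)"
proof -
  have add: "y \<in> vecs double \<Longrightarrow> act (x + y) \<beta> = act x \<beta> + act y \<beta>"
    and scale: "act (smul double c x) \<beta> = sV c (act x \<beta>)"
    if "x \<in> vecs double" for x y c
    using act_bilinear that by (auto simp: bilinear_map_def linear_map_def)
  have "pure (smul H_dual c f) a = smul double c (pure f a)" "pure f (sH c a) = smul double c (pure f a)"
    if "f \<in> vecs H_dual" for f c a
    using pure_tensor_scale_left[of f H_dual a H c] pure_tensor_scale_right[of f H_dual a H c] that
    by (simp_all add: double_def)
  thus ?thesis
    by (auto simp: bilinear_map_def linear_map_def pure_tensor_add_left pure_tensor_add_right
        add scale pure_mem simp del: plus_fun_apply)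
qed

text \<open>Linearity of the action in \<open>x\<close> reduces it to pure tensors; since a tensor
  is a functional, the result is its value at the matrix coefficient.\<close>

lemma act_apply:
  assumes p: "lin sV \<phi>" and x: "x \<in> vecs double"
  shows "\<phi> (act x \<beta>) = x (\<lambda>f a. \<phi> (act (pure f a) \<beta>))"
proof -
  have "linear_map double scalars (\<lambda>x. \<phi> (act x \<beta>))"
    using act_bilinear p by (simp add: bilinear_map_def linear_map_def lin_def)
  hence "\<phi> (act x \<beta>) = tensor_sum H_dual H x (\<lambda>f a. \<phi> (act (pure f a) \<beta>))"
    using x unfolding double_def by (rule linear_on_tensor)
  also have "\<dots> = x (\<lambda>f a. \<phi> (act (pure f a) \<beta>))"
    by (rule tensor_apply[OF lin_bilinear[OF p act_pure_bilinear] x[unfolded double_def], symmetric])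
  finally show ?thesis .
qed

lemma act_act_pure:
  assumes p: "lin sV \<phi>" and fg: "f \<in> vecs H_dual" "g \<in> vecs H_dual"
  shows "\<phi> (act (pure f a) (act (pure g b) \<beta>)) =
    double_mult (pure f a) (pure g b) (\<lambda>f a. \<phi> (act (pure f a) \<beta>))"
proof -
  note m = fg[THEN pure_mem]
  have "act (pure f a) (act (pure g b) \<beta>) = act (double_mult (pure f a) (pure g b)) \<beta>"
    by (rule act_mult[symmetric]) (rule m)+
  thus ?thesis using act_apply[OF p double_mult_mem[OF m]] by simp
qed

lemma act_pure_counit:
  assumes f: "f \<in> vecs H_dual"
  shows "act (pure f a) (act (pure \<epsilon> b) \<beta>) = act (pure f (a * b)) \<beta>"
proof (rule vector_eqI[OF V.vector_space_axioms])
  fix \<phi> assume p: "lin sV \<phi>"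
  show "\<phi> (act (pure f a) (act (pure \<epsilon> b) \<beta>)) = \<phi> (act (pure f (a * b)) \<beta>)"
    unfolding act_act_pure[OF p f counit_mem]
    by (rule double_mult_pure_counit[OF lin_bilinear[OF p act_pure_bilinear] f])
qed

lemma module_dual_action_mult:
  assumes fg: "f \<in> vecs H_dual" "g \<in> vecs H_dual"
  shows "module_dual_action f (module_dual_action g \<beta>) = module_dual_action (dual_mult f g) \<beta>"
proof (rule vector_eqI[OF V.vector_space_axioms])
  fix \<phi> assume p: "lin sV \<phi>"
  show "\<phi> (module_dual_action f (module_dual_action g \<beta>)) = \<phi> (module_dual_action (dual_mult f g) \<beta>)"
    unfolding module_dual_action_def act_act_pure[OF p fg]
    by (rule double_mult_pure_one[OF lin_bilinear[OF p act_pure_bilinear] fg])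
qed

text \<open>f \<infinity> a factors as f \<infinity> 1 times \<epsilon> \<infinity> a, so the two
  restricted actions determine the whole module.\<close>

lemma act_pure_eq:
  "f \<in> vecs H_dual \<Longrightarrow> act (pure f a) \<beta> = module_dual_action f (module_action a \<beta>)"
  by (simp add: module_dual_action_def module_action_def act_pure_counit)

text \<open>Comes from the product of \<epsilon> \<infinity> a and g \<infinity> 1, in which
  \<epsilon> is the unit for convolution. This is the source of
  \<open>double_compat\<close>.\<close>

lemma module_action_dual_action:
  assumes p: "lin sV \<phi>" and g: "g \<in> vecs H_dual"
  shows "\<phi> (module_action a (module_dual_action g \<beta>)) =
    sweedler a (\<lambda>x w. sweedler w (\<lambda>y z. \<phi> (module_dual_action (twisted g x z) (module_action y \<beta>))))"
  unfolding module_action_def[of a] module_dual_action_def[of g] act_act_pure[OF p counit_mem g]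
    double_mult_pure_apply[OF lin_bilinear[OF p act_pure_bilinear] counit_mem g]
  by (simp add: dual_mult_counit twisted_mem g act_pure_eq)

lemma module_action_bilinear: "bilinear_map H V V module_action"
  using act_pure_bilinear act_bilinear pure_mem[OF counit_mem] counit_mem
  unfolding bilinear_map_def module_action_def by (simp add: linear_map_def)

lemma left_module_module_action: "left_module H (*) 1 V module_action"
  unfolding left_module_def using module_action_bilinear
  by (simp add: module_action_def act_pure_counit counit_mem act_one[unfolded double_one_def])

lemma module_dual_action_linear:
  assumes "f \<in> vecs H_dual"
  shows "module_dual_action f (\<beta> + \<gamma>) = module_dual_action f \<beta> + module_dual_action f \<gamma>"
    "module_dual_action f (sV c \<beta>) = sV c (module_dual_action f \<beta>)"
  using act_bilinear pure_mem[OF assms] by (auto simp: module_dual_action_def bilinear_map_def linear_map_def)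

lemma module_coaction_linear: "linear_map V (tensor_space V H) module_coaction"
proof -
  have sc: "pure_tensor V H (sV c u) v = smul (tensor_space V H) c (pure_tensor V H u v)" for c u v
    using pure_tensor_scale_left[of u V v H c] by simp
  have "module_coaction (\<beta> + \<gamma>) = module_coaction \<beta> + module_coaction \<gamma>" for \<beta> \<gamma>
    unfolding module_coaction_def sum.distrib[symmetric]
    by (intro sum.cong refl) (simp add: module_dual_action_linear coord_mem pure_tensor_add_left del: plus_fun_apply)
  moreover have "module_coaction (sV c \<beta>) = smul (tensor_space V H) c (module_coaction \<beta>)" for c \<beta>
    unfolding module_coaction_def
    by (simp add: module_dual_action_linear coord_mem sc cong: sum.cong)
      (simp add: tensor_space_def fun_eq_iff sum_fun_apply sum_distrib_left)
  moreover have "module_coaction \<beta> \<in> vecs (tensor_space V H)" for \<beta>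
    unfolding module_coaction_def by (intro tensor_space_sum pure_tensor_mem) auto
  ultimately show ?thesis by (simp add: linear_map_def del: plus_fun_apply)
qed

lemma dsum_module_coaction:
  assumes B: "bilinear_map V H scalars B"
  shows "dsum module_coaction \<beta> B = (\<Sum>b\<in>basis. B (module_dual_action (coord b) \<beta>) b)"
proof -
  have "module_coaction \<beta> \<in> vecs (tensor_space V H)"
    using module_coaction_linear by (simp add: linear_map_def)
  from tensor_apply[OF B this] show ?thesis
    by (simp add: module_coaction_def sum_fun_apply) (simp add: pure_tensor_def B)
qed

lemma lin_module_dual_action: "lin sV \<phi> \<Longrightarrow> linear_map H_dual scalars (\<lambda>f. \<phi> (module_dual_action f \<beta>))"
  using lin_bilinear[OF _ act_pure_bilinear, of \<phi> \<beta>]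
  by (simp add: bilinear_map_dual_H_iff module_dual_action_def)

text \<open>Acting through the coaction gives the sum of \<open>f b\<close> times the action of
  \<open>coord b\<close>, which is the action of \<open>f\<close> by the dual basis
  expansion.\<close>

lemma dual_action_module_coaction:
  assumes f: "f \<in> vecs H_dual"
  shows "dual_action module_coaction f \<beta> = module_dual_action f \<beta>"
proof (rule vector_eqI[OF V.vector_space_axioms])
  fix \<phi> assume p: "lin sV \<phi>"
  have f': "lin sH f" using f by (simp add: vecs_dual_space)
  show "\<phi> (dual_action module_coaction f \<beta>) = \<phi> (module_dual_action f \<beta>)"
    unfolding dual_action_lin[OF p] dsum_module_coaction[OF bilinear_map_form[OF p f']]
    by (rule linear_map_dual_expand[OF lin_module_dual_action[OF p] f, symmetric])
qed

lemma double_compat_module: "double_compat module_action module_coaction"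
  unfolding double_compat_def
proof (intro allI impI)
  fix a \<beta> and B :: "'v \<Rightarrow> 'h \<Rightarrow> 'k" assume B: "bilinear_map V H scalars B"
  have B1: "lin sV (\<lambda>v. B v i)" for i using B by (simp add: bilinear_map_full_iff)
  have "bilinear_map V H scalars (\<lambda>v h. B (module_action a v) h)"
    using B module_action_bilinear by (simp add: lin_simps bilinear_map_V_iff)
  hence "dsum module_coaction \<beta> (\<lambda>v h. B (module_action a v) h) =
      (\<Sum>i\<in>basis. B (module_action a (module_dual_action (coord i) \<beta>)) i)"
    by (rule dsum_module_coaction)
  also have "\<dots> = (\<Sum>i\<in>basis. sweedler a (\<lambda>x w. sweedler w (\<lambda>y z.
      B (module_dual_action (twisted (coord i) x z) (module_action y \<beta>)) i)))"
    by (intro sum.cong refl module_action_dual_action[OF B1] coord_mem)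
  also have "\<dots> = sweedler a (\<lambda>x w. sweedler w (\<lambda>y z. \<Sum>i\<in>basis.
      B (dual_action module_coaction (\<lambda>h. coord i (S z * h * x)) (module_action y \<beta>)) i))"
  proof -
    have "B (module_dual_action (twisted (coord i) x z) \<gamma>) i =
        B (dual_action module_coaction (\<lambda>h. coord i (S z * h * x)) \<gamma>) i" if "i \<in> basis" for i x z \<gamma>
      unfolding twisted_def[symmetric] using that
      by (simp add: dual_action_module_coaction twisted_mem coord_mem)
    thus ?thesis by (simp add: sweedler_sum cong: sum.cong)
  qed
  \<comment> \<open>\<open>dsum_expand_fun\<close> read backwards: the substitution in the second
    argument undoes the twist of the coordinate functionals.\<close>
  also have "\<dots> = sweedler a (\<lambda>x w. sweedler w (\<lambda>y z. dsum module_coaction (module_action y \<beta>) (\<lambda>v h. B v (S z * h * x))))"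
    by (simp only: dsum_expand_fun[OF B, where k = "\<lambda>h. S z * h * x" for z x])
  finally show "dsum module_coaction \<beta> (\<lambda>v h. B (module_action a v) h) =
     sweedler a (\<lambda>x w. sweedler w (\<lambda>y z. dsum module_coaction (module_action y \<beta>) (\<lambda>v h. B v (S z * h * x))))" .
qed

text \<open>The structure constants of convolution in the dual basis are those of the coproduct of
  H, so associativity of the dual action becomes coassociativity.\<close>

lemma coaction_coassoc_module: "coaction_coassoc module_coaction"
  unfolding coaction_coassoc_def
proof (intro allI impI)
  fix \<beta> and F :: "'v \<Rightarrow> 'h \<Rightarrow> 'h \<Rightarrow> 'k"
  assume F: "(\<forall>x y. lin sV (\<lambda>v. F v x y)) \<and> (\<forall>v y. lin sH (\<lambda>x. F v x y)) \<and> (\<forall>v x. lin sH (\<lambda>y. F v x y))"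
  have b1: "bilinear_map V H scalars (\<lambda>v h. F v h u)" for u
    using F by (simp add: bilinear_map_full_iff)
  have b2: "bilinear_map V H scalars (\<lambda>v h. dsum module_coaction v (\<lambda>v' h'. F v' h' h))"
    unfolding bilinear_map_full_iff
    using lin_dsum[OF module_coaction_linear b1] F
    by (simp add: lin_def tensor_sum_add tensor_sum_mult_left)
  have b3: "bilinear_map V H scalars (\<lambda>v h. sweedler h (\<lambda>x y. F v x y))"
  proof -
    have "F (v + v') = (\<lambda>x y. F v x y + F v' x y)" "F (sV c v) = (\<lambda>x y. c * F v x y)" for v v' c
      using F by (auto simp: lin_def fun_eq_iff)
    hence "lin sV (\<lambda>v. sweedler h (F v))" for h
      by (simp add: lin_def sweedler_add sweedler_mult_left)
    thus ?thesis using F by (simp add: bilinear_map_full_iff lin_sweedler)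
  qed
  let ?G = "\<lambda>i c b. F (module_dual_action (coord i) \<beta>) c b"
  have "dsum module_coaction \<beta> (\<lambda>v h. dsum module_coaction v (\<lambda>v' h'. F v' h' h)) =
      (\<Sum>b\<in>basis. \<Sum>c\<in>basis. F (module_dual_action (coord c) (module_dual_action (coord b) \<beta>)) c b)"
    unfolding dsum_module_coaction[OF b2] by (simp add: dsum_module_coaction[OF b1])
  also have "\<dots> = (\<Sum>b\<in>basis. \<Sum>c\<in>basis. \<Sum>i\<in>basis. dual_mult (coord c) (coord b) i * ?G i c b)"
  proof (intro sum.cong refl)
    fix b c assume bc: "b \<in> basis" "c \<in> basis"
    have p: "lin sV (\<lambda>v. F v c b)" using F by simp
    show "F (module_dual_action (coord c) (module_dual_action (coord b) \<beta>)) c b =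
        (\<Sum>i\<in>basis. dual_mult (coord c) (coord b) i * ?G i c b)"
      unfolding module_dual_action_mult[OF coord_mem[OF bc(2)] coord_mem[OF bc(1)]]
      by (rule linear_map_dual_expand[OF lin_module_dual_action[OF p] dual_mult_mem]) (rule coord_mem bc)+
  qed
  also have "\<dots> = (\<Sum>i\<in>basis. \<Sum>c\<in>basis. \<Sum>b\<in>basis. dual_mult (coord c) (coord b) i * ?G i c b)"
    by (subst sum.swap, subst (2) sum.swap, subst sum.swap) (rule refl)
  also have "\<dots> = (\<Sum>i\<in>basis. sweedler i (\<lambda>x y. F (module_dual_action (coord i) \<beta>) x y))"
  proof (rule sum.cong[OF refl])
    fix i
    have "F v x y = (\<Sum>c\<in>basis. \<Sum>b\<in>basis. coord c x * coord b y * F v c b)" for v x y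
    proof -
      have "F v x y = (\<Sum>c\<in>basis. coord c x * F v c y)"
        by (rule lin_expand) (use F in simp)
      also have "\<dots> = (\<Sum>c\<in>basis. coord c x * (\<Sum>b\<in>basis. coord b y * F v c b))"
        by (intro sum.cong refl arg_cong2[where f = "(*)"] lin_expand) (use F in simp)
      finally show ?thesis by (simp add: sum_distrib_left mult.assoc)
    qed
    hence "sweedler i (\<lambda>x y. F (module_dual_action (coord i) \<beta>) x y) =
        sweedler i (\<lambda>x y. \<Sum>c\<in>basis. \<Sum>b\<in>basis. coord c x * coord b y * ?G i c b)"
      by (rule sweedler_cong)
    thus "(\<Sum>c\<in>basis. \<Sum>b\<in>basis. dual_mult (coord c) (coord b) i * ?G i c b) =
        sweedler i (\<lambda>x y. F (module_dual_action (coord i) \<beta>) x y)"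
      by (simp add: sweedler_sum sweedler_mult_right dual_mult_def)
  qed
  also have "\<dots> = dsum module_coaction \<beta> (\<lambda>v h. sweedler h (\<lambda>x y. F v x y))"
    by (simp add: dsum_module_coaction[OF b3])
  finally show "dsum module_coaction \<beta> (\<lambda>v h. dsum module_coaction v (\<lambda>v' h'. F v' h' h)) =
    dsum module_coaction \<beta> (\<lambda>v h. sweedler h (\<lambda>x y. F v x y))" .
qed

lemma crossed_bimodule_of_module:
  "crossed_bimodule sV module_action module_coaction" "twist_condition sV module_action module_coaction"
proof -
  have "dsum module_coaction \<beta> (\<lambda>v h. sV (\<epsilon> h) v) = \<beta>" for \<beta>
    using dual_action_module_coaction[OF counit_mem, of \<beta>]
    by (simp add: dual_action_def module_dual_action_def act_one[unfolded double_one_def])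
  with double_compat_module
  show "crossed_bimodule sV module_action module_coaction" "twist_condition sV module_action module_coaction"
    by (simp_all add: crossed_bimodule_iff twist_condition_iff left_module_module_action
        module_coaction_linear coaction_coassoc_module
        double_compat_iff[OF module_action_bilinear module_coaction_linear])
qed

text \<open>The action is recovered on the carrier only; elsewhere \<open>double_action\<close> has
  the default value of \<open>restrict\<close>, while \<open>act\<close> is arbitrary.\<close>

lemma double_action_of_module:
  assumes x: "x \<in> vecs double"
  shows "double_action sV module_action module_coaction x = act x"
proof
  fix \<beta>
  show "double_action sV module_action module_coaction x \<beta> = act x \<beta>"
  proof (rule vector_eqI[OF V.vector_space_axioms])
    fix \<phi> assume p: "lin sV \<phi>"
    have "\<phi> (double_action sV module_action module_coaction x \<beta>) =
        tensor_sum H_dual H x (\<lambda>f a. \<phi> (dual_action module_coaction f (module_action a \<beta>)))"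
      unfolding double_action_eq[OF x]
      by (rule tensor_sum_hom) (use p in \<open>auto simp: lin_zero lin_add\<close>)
    also have "\<dots> = tensor_sum H_dual H x (\<lambda>f a. \<phi> (act (pure f a) \<beta>))"
      by (rule tensor_sum_cong[OF x[unfolded double_def]]) (simp add: dual_action_module_coaction act_pure_eq)
    also have "\<dots> = \<phi> (act x \<beta>)"
      unfolding act_apply[OF p x]
      by (rule tensor_apply[OF lin_bilinear[OF p act_pure_bilinear] x[unfolded double_def], symmetric])
    finally show "\<phi> (double_action sV module_action module_coaction x \<beta>) = \<phi> (act x \<beta>)" .
  qed
qed

end

lemma crossed_bimodule_exists:
  assumes "double_module sV act"
  shows "\<exists>\<mu> \<delta>. crossed_bimodule sV \<mu> \<delta> \<and> twist_condition sV \<mu> \<delta> \<and>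
    (\<forall>x\<in>vecs double. double_action sV \<mu> \<delta> x = act x)"
  using crossed_bimodule_of_module[OF assms] double_action_of_module[OF assms] by blast

lemma bij_betw_double_action:
  "bij_betw (\<lambda>(\<mu>, \<delta>). double_action sV \<mu> \<delta>)
     {(\<mu>, \<delta>). crossed_bimodule sV \<mu> \<delta> \<and> twist_condition sV \<mu> \<delta>}
     {act. act \<in> extensional (vecs double) \<and> double_module sV act}"
proof -
  have ext: "double_action sV \<mu> \<delta> \<in> extensional (vecs double)" for \<mu> \<delta>
    by (simp add: double_action_def)
  have "\<exists>\<mu> \<delta>. crossed_bimodule sV \<mu> \<delta> \<and> twist_condition sV \<mu> \<delta> \<and> double_action sV \<mu> \<delta> = act"
    if "act \<in> extensional (vecs double)" "double_module sV act" for act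
    \<comment> \<open>Both functions are extensional, so agreement on the carrier of the double
      gives equality.\<close>
    using crossed_bimodule_exists[OF that(2)] extensionalityI[OF ext that(1)] by metis
  thus ?thesis
    unfolding bij_betw_def inj_on_def
    by (auto simp: ext double_module_of_crossed image_iff dest: double_action_inj)
qed

end

theorem mainTheorem3:
  fixes sH :: "'k::field \<Rightarrow> 'h::ring_1 \<Rightarrow> 'h"
    and \<Delta> :: "'h \<Rightarrow> ('h \<Rightarrow> 'h \<Rightarrow> 'k) \<Rightarrow> 'k"
    and \<epsilon> :: "'h \<Rightarrow> 'k"
    and T :: "'h \<Rightarrow> 'h"
    and sV :: "'k \<Rightarrow> 'v::ab_group_add \<Rightarrow> 'v"
  assumes "biperfect_weak_hopf_algebra sH \<Delta> \<epsilon> T"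
    and "\<exists>B. finite B \<and> module.span sH B = UNIV"
    and "bij T"
    and "vector_space sV"
  shows "((\<exists>act. biperfect_weak_hopf_algebra.double_module sH \<Delta> \<epsilon> T sV act) \<longleftrightarrow>
          (\<exists>\<mu> \<delta>. bialgebra.crossed_bimodule sH \<Delta> \<epsilon> sV \<mu> \<delta> \<and>
                 biperfect_weak_hopf_algebra.twist_condition sH \<Delta> T sV \<mu> \<delta>)) \<and>
         bij_betw (\<lambda>(\<mu>, \<delta>). biperfect_weak_hopf_algebra.double_action sH sV \<mu> \<delta>)
           {(\<mu>, \<delta>). bialgebra.crossed_bimodule sH \<Delta> \<epsilon> sV \<mu> \<delta> \<and>
                    biperfect_weak_hopf_algebra.twist_condition sH \<Delta> T sV \<mu> \<delta>}
           {act. act \<in> extensional (vecs (biperfect_weak_hopf_algebra.double sH)) \<and>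
                 biperfect_weak_hopf_algebra.double_module sH \<Delta> \<epsilon> T sV act}"
proof -
  interpret fd_biperfect_space sH \<Delta> \<epsilon> T sV
    using assms by (simp add: fd_biperfect_space_def fd_biperfect_def fd_biperfect_axioms_def)
  show ?thesis
    using crossed_bimodule_exists double_module_of_crossed bij_betw_double_action by blast
qed

end
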